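(* Let $\Bbbk$ be a field of characteristic not $2$, let $\delta\in\Bbbk$ with $\delta\neq-2$, and let $\alpha\in\Bbbk^\times$. If $\mathcal I$ is a tensor ideal of $\mathcal T_{\delta,\alpha}$ such that $$\dim_{\Bbbk}\left((\mathcal T_{\delta,\alpha}/\mathcal I)(X^{\otimes 2},X^{\otimes 2})\right)=5,$$ then, in $\mathcal T_{\delta,\alpha}/\mathcal I$, the object $X$ is either a Lie algebra object (with bracket $m$) or a vector product algebra object (with multiplication $m$ and a suitable cup and cap).
   Context: All categories are $\Bbbk$-linear; $\mathcal C(Y,Z)$ denotes the space of morphisms $Y\to Z$ in $\mathcal C$. $\mathcal T_{\delta,\alpha}$ is the strict $\Bbbk$-linear monoidal category (unit object $\mathbf 1$) generated by one object $X$ and morphisms $$m\colon X\otimes X\to X,\quad s\colon X\otimes X\to X\otimes X,\quad \eta\colon\mathbf 1\to X\otimes X,\quad \varepsilon\colon X\otimes X\to\mathbf 1,$$ subject to the following relations (writing $1$ for $\mathrm{id}_X$ and composing right to left): (i) $(\varepsilon\otimes1)(1\otimes\eta)=1=(1\otimes\varepsilon)(\eta\otimes1)$; (ii) $\sigma:=(1\otimes m)(\eta\otimes 1)=(m\otimes1)(1\otimes\eta)\colon X\to X\otimes X$; (iii) $(1\otimes\varepsilon)(s\otimes1)=(\varepsilon\otimes1)(1\otimes s)$; (iv) $s\circ s=1\otimes1$ and $(s\otimes1)(1\otimes s)(s\otimes1)=(1\otimes s)(s\otimes1)(1\otimes s)$; (v) $(1\otimes m)(s\otimes1)(1\otimes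 s)=s(m\otimes1)$ and $(1\otimes s)(s\otimes1)(1\otimes\sigma)=(\sigma\otimes1)s$; (vi) $\varepsilon s=\varepsilon$, $\; m s=-m$, $\; m\sigma=\alpha\,1$, $\;\varepsilon\eta=\delta\,\mathrm{id}_{\mathbf 1}$. It is symmetric monoidal with braiding determined by $s$. A tensor ideal $\mathcal I$ of a $\Bbbk$-linear monoidal category $\mathcal C$ is a collection of subspaces $\mathcal I(Y,Z)\subseteq\mathcal C(Y,Z)$, for all objects $Y,Z$, closed under composition on either side with arbitrary morphisms of $\mathcal C$ and under tensoring on either side with identity morphisms. The quotient $\mathcal C/\mathcal I$ has the same objects as $\mathcal C$ and morphism spaces $\mathcal C(Y,Z)/\mathcal I(Y,Z)$. A Lie algebra object in a symmetric $\Bbbk$-linear monoidal category with braiding $s$ is an object $L$ with a morphism $\beta\colon L\otimes L\to L$ such that $\beta s=-\beta$ and $\beta(\beta\otimes1)(1\otimes s)=\beta(\beta\otimes1)-\beta(1\otimes\beta)$. A vector product algebra object in such a category is an object $V$ with morphisms (multiplication) $m'\colon V\otimes V\to V$, (cup) $\eta'\colon\mathbf 1\to V\otimes V$, (cap) $\varepsilon'\colon V\otimes V\to\mathbf 1$ satisfying the analogues of relations (i), (ii), (iii), $\varepsilon's=\varepsilon'$, $m's=-m'$, and $$m'(m'\otimes1)+m'(1\otimes m')=2\,(1\otimes\varepsilon')(s\otimes1)-(1\otimes\varepsilon')-(\varepsilon'\otimes1)$$ as morphisms $V^{\otimes3}\to V$. *)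

theory Defs
  imports "Jordan_Normal_Form.VS_Connect" "HOL-Algebra.AbelCoset"
begin

section \<open>Strict linear monoidal categories\<close>

text \<open>Every element of the type of objects is an object.  Hom-spaces are modules in the
  sense of HOL-Algebra, of which only the additive and the scalar structure is used.
  Composition and tensor product of morphisms carry no object arguments: hom-spaces between
  different pairs of objects are understood to be disjoint.\<close>

record ('o, 'm, 'k) monoidal_cat =
  Hom :: "'o \<Rightarrow> 'o \<Rightarrow> ('k, 'm) module"
  Idm :: "'o \<Rightarrow> 'm" (\<open>\<i>\<index>\<close>)
  cmp :: "'m \<Rightarrow> 'm \<Rightarrow> 'm" (infixl \<open>\<cdot>\<index>\<close> 73)
  Unit :: "'o" (\<open>\<u>\<index>\<close>)
  tob :: "'o \<Rightarrow> 'o \<Rightarrow> 'o" (infixl \<open>\<otimes>\<^sub>o\<index>\<close> 75)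
  tmor :: "'m \<Rightarrow> 'm \<Rightarrow> 'm" (infixl \<open>\<otimes>\<^sub>m\<index>\<close> 75)
  Braid :: "'o \<Rightarrow> 'o \<Rightarrow> 'm"

definition tensor_ideal ::
    "('o, 'm, 'k::field) monoidal_cat \<Rightarrow> ('o \<Rightarrow> 'o \<Rightarrow> 'm set) \<Rightarrow> bool" where
  "tensor_ideal C I \<longleftrightarrow>
     (\<forall>Y Z. subspace class_ring (I Y Z) (Hom C Y Z)) \<and>
     (\<forall>W Y Z. \<forall>f \<in> I Y Z. \<forall>g \<in> carrier (Hom C Z W). g \<cdot>\<^bsub>C\<^esub> f \<in> I Y W) \<and>
     (\<forall>W Y Z. \<forall>f \<in> I Y Z. \<forall>g \<in> carrier (Hom C W Y). f \<cdot>\<^bsub>C\<^esub> g \<in> I W Z) \<and>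
     (\<forall>W Y Z. \<forall>f \<in> I Y Z. f \<otimes>\<^sub>m\<^bsub>C\<^esub> \<i>\<^bsub>C\<^esub> W \<in> I (Y \<otimes>\<^sub>o\<^bsub>C\<^esub> W) (Z \<otimes>\<^sub>o\<^bsub>C\<^esub> W)) \<and>
     (\<forall>W Y Z. \<forall>f \<in> I Y Z. \<i>\<^bsub>C\<^esub> W \<otimes>\<^sub>m\<^bsub>C\<^esub> f \<in> I (W \<otimes>\<^sub>o\<^bsub>C\<^esub> Y) (W \<otimes>\<^sub>o\<^bsub>C\<^esub> Z))"

definition quotient_space :: "('k, 'm) module \<Rightarrow> 'm set \<Rightarrow> ('k, 'm set) module" where
  "quotient_space M W =
     \<lparr>carrier = a_rcosets\<^bsub>M\<^esub> W, mult = undefined, one = undefined,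
      zero = W, add = set_add M,
      smult = (\<lambda>c F. \<Union>f \<in> F. W +>\<^bsub>M\<^esub> (c \<odot>\<^bsub>M\<^esub> f))\<rparr>"

text \<open>The coset of a morphism modulo the member of the ideal in its own hom-space.\<close>

definition ideal_coset ::
    "('o, 'm, 'k) monoidal_cat \<Rightarrow> ('o \<Rightarrow> 'o \<Rightarrow> 'm set) \<Rightarrow> 'm \<Rightarrow> 'm set" where
  "ideal_coset C I f = {g. \<exists>Y Z. f \<in> carrier (Hom C Y Z) \<and> g \<in> I Y Z +>\<^bsub>Hom C Y Z\<^esub> f}"

text \<open>Composites and tensor products of two cosets need not fill a coset, hence the coset is
  taken again after operating on representatives.\<close>

definition quotient_cat ::
    "('o, 'm, 'k) monoidal_cat \<Rightarrow> ('o \<Rightarrow> 'o \<Rightarrow> 'm set) \<Rightarrow> ('o, 'm set, 'k) monoidal_cat" where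
  "quotient_cat C I =
     \<lparr>Hom = (\<lambda>Y Z. quotient_space (Hom C Y Z) (I Y Z)),
      Idm = (\<lambda>Y. ideal_coset C I (\<i>\<^bsub>C\<^esub> Y)),
      cmp = (\<lambda>G F. \<Union>g \<in> G. \<Union>f \<in> F. ideal_coset C I (g \<cdot>\<^bsub>C\<^esub> f)),
      Unit = \<u>\<^bsub>C\<^esub>,
      tob = tob C,
      tmor = (\<lambda>F G. \<Union>f \<in> F. \<Union>g \<in> G. ideal_coset C I (f \<otimes>\<^sub>m\<^bsub>C\<^esub> g)),
      Braid = (\<lambda>Y Z. ideal_coset C I (Braid C Y Z))\<rparr>"


section \<open>Lie algebra and vector product algebra objects\<close>

definition lie_algebra_object ::
    "('o, 'm, 'k) monoidal_cat \<Rightarrow> 'o \<Rightarrow> 'm \<Rightarrow> bool" where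
  "lie_algebra_object C L \<beta> \<longleftrightarrow>
     (let i = \<i>\<^bsub>C\<^esub> L; s = Braid C L L; L2 = L \<otimes>\<^sub>o\<^bsub>C\<^esub> L; L3 = L2 \<otimes>\<^sub>o\<^bsub>C\<^esub> L in
      \<beta> \<in> carrier (Hom C L2 L) \<and>
      \<beta> \<cdot>\<^bsub>C\<^esub> s = \<ominus>\<^bsub>Hom C L2 L\<^esub> \<beta> \<and>
      \<beta> \<cdot>\<^bsub>C\<^esub> (\<beta> \<otimes>\<^sub>m\<^bsub>C\<^esub> i) \<cdot>\<^bsub>C\<^esub> (i \<otimes>\<^sub>m\<^bsub>C\<^esub> s) =
        \<beta> \<cdot>\<^bsub>C\<^esub> (\<beta> \<otimes>\<^sub>m\<^bsub>C\<^esub> i) \<ominus>\<^bsub>Hom C L3 L\<^esub> \<beta> \<cdot>\<^bsub>C\<^esub> (i \<otimes>\<^sub>m\<^bsub>C\<^esub> \<beta>))"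

definition vector_product_algebra_object ::
    "('o, 'm, 'k::field) monoidal_cat \<Rightarrow> 'o \<Rightarrow> 'm \<Rightarrow> 'm \<Rightarrow> 'm \<Rightarrow> bool" where
  "vector_product_algebra_object C V \<mu> \<eta> \<epsilon> \<longleftrightarrow>
     (let i = \<i>\<^bsub>C\<^esub> V; s = Braid C V V; V2 = V \<otimes>\<^sub>o\<^bsub>C\<^esub> V; V3 = V2 \<otimes>\<^sub>o\<^bsub>C\<^esub> V in
      \<mu> \<in> carrier (Hom C V2 V) \<and>
      \<eta> \<in> carrier (Hom C \<u>\<^bsub>C\<^esub> V2) \<and>
      \<epsilon> \<in> carrier (Hom C V2 \<u>\<^bsub>C\<^esub>) \<and>
      (\<epsilon> \<otimes>\<^sub>m\<^bsub>C\<^esub> i) \<cdot>\<^bsub>C\<^esub> (i \<otimes>\<^sub>m\<^bsub>C\<^esub> \<eta>) = i \<and>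
      i = (i \<otimes>\<^sub>m\<^bsub>C\<^esub> \<epsilon>) \<cdot>\<^bsub>C\<^esub> (\<eta> \<otimes>\<^sub>m\<^bsub>C\<^esub> i) \<and>
      (i \<otimes>\<^sub>m\<^bsub>C\<^esub> \<mu>) \<cdot>\<^bsub>C\<^esub> (\<eta> \<otimes>\<^sub>m\<^bsub>C\<^esub> i) = (\<mu> \<otimes>\<^sub>m\<^bsub>C\<^esub> i) \<cdot>\<^bsub>C\<^esub> (i \<otimes>\<^sub>m\<^bsub>C\<^esub> \<eta>) \<and>
      (i \<otimes>\<^sub>m\<^bsub>C\<^esub> \<epsilon>) \<cdot>\<^bsub>C\<^esub> (s \<otimes>\<^sub>m\<^bsub>C\<^esub> i) = (\<epsilon> \<otimes>\<^sub>m\<^bsub>C\<^esub> i) \<cdot>\<^bsub>C\<^esub> (i \<otimes>\<^sub>m\<^bsub>C\<^esub> s) \<and>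
      \<epsilon> \<cdot>\<^bsub>C\<^esub> s = \<epsilon> \<and>
      \<mu> \<cdot>\<^bsub>C\<^esub> s = \<ominus>\<^bsub>Hom C V2 V\<^esub> \<mu> \<and>
      \<mu> \<cdot>\<^bsub>C\<^esub> (\<mu> \<otimes>\<^sub>m\<^bsub>C\<^esub> i) \<oplus>\<^bsub>Hom C V3 V\<^esub> \<mu> \<cdot>\<^bsub>C\<^esub> (i \<otimes>\<^sub>m\<^bsub>C\<^esub> \<mu>) =
        (2 \<odot>\<^bsub>Hom C V3 V\<^esub> ((i \<otimes>\<^sub>m\<^bsub>C\<^esub> \<epsilon>) \<cdot>\<^bsub>C\<^esub> (s \<otimes>\<^sub>m\<^bsub>C\<^esub> i))
           \<ominus>\<^bsub>Hom C V3 V\<^esub> (i \<otimes>\<^sub>m\<^bsub>C\<^esub> \<epsilon>)) \<ominus>\<^bsub>Hom C V3 V\<^esub> (\<epsilon> \<otimes>\<^sub>m\<^bsub>C\<^esub> i))"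


section \<open>The category given by generators and relations\<close>

text \<open>Objects are natural numbers, \<open>n\<close> standing for the \<open>n\<close>-th tensor power of the generating
  object, so that the tensor product of objects is addition and the unit object is 0.
  Morphisms are classes of formal expressions.\<close>

datatype 'k tm =
    TId nat | TZero nat nat
  | Mult | Swap | Cup | Cap
  | TComp "'k tm" "'k tm" (infixl \<open>\<cdot>\<^sub>t\<close> 73)
  | TTens "'k tm" "'k tm" (infixl \<open>\<otimes>\<^sub>t\<close> 75)
  | TAdd "'k tm" "'k tm" (infixl \<open>+\<^sub>t\<close> 65)
  | TScale 'k "'k tm" (infixr \<open>*\<^sub>t\<close> 70)

abbreviation TOne :: "'k tm" (\<open>\<one>\<^sub>t\<close>) where "\<one>\<^sub>t \<equiv> TId (Suc 0)"

inductive typed :: "'k tm \<Rightarrow> nat \<Rightarrow> nat \<Rightarrow> bool" (\<open>_ : _ \<rightarrow>\<^sub>t _\<close> [51, 51, 51] 50) where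
  "TId n : n \<rightarrow>\<^sub>t n"
| "TZero m n : m \<rightarrow>\<^sub>t n"
| "Mult : 2 \<rightarrow>\<^sub>t 1"
| "Swap : 2 \<rightarrow>\<^sub>t 2"
| "Cup : 0 \<rightarrow>\<^sub>t 2"
| "Cap : 2 \<rightarrow>\<^sub>t 0"
| "g : m \<rightarrow>\<^sub>t n \<Longrightarrow> f : l \<rightarrow>\<^sub>t m \<Longrightarrow> g \<cdot>\<^sub>t f : l \<rightarrow>\<^sub>t n"
| "f : k \<rightarrow>\<^sub>t l \<Longrightarrow> g : m \<rightarrow>\<^sub>t n \<Longrightarrow> f \<otimes>\<^sub>t g : k + m \<rightarrow>\<^sub>t l + n"
| "f : m \<rightarrow>\<^sub>t n \<Longrightarrow> g : m \<rightarrow>\<^sub>t n \<Longrightarrow> f +\<^sub>t g : m \<rightarrow>\<^sub>t n"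
| "f : m \<rightarrow>\<^sub>t n \<Longrightarrow> c *\<^sub>t f : m \<rightarrow>\<^sub>t n"

abbreviation Split :: "'k tm" (\<open>\<sigma>\<^sub>t\<close>) where "\<sigma>\<^sub>t \<equiv> (\<one>\<^sub>t \<otimes>\<^sub>t Mult) \<cdot>\<^sub>t (Cup \<otimes>\<^sub>t \<one>\<^sub>t)"

definition defining_relations :: "'k::field \<Rightarrow> 'k \<Rightarrow> ('k tm \<times> 'k tm) set" where
  "defining_relations \<delta> \<alpha> = {
     ((Cap \<otimes>\<^sub>t \<one>\<^sub>t) \<cdot>\<^sub>t (\<one>\<^sub>t \<otimes>\<^sub>t Cup), \<one>\<^sub>t),
     (\<one>\<^sub>t, (\<one>\<^sub>t \<otimes>\<^sub>t Cap) \<cdot>\<^sub>t (Cup \<otimes>\<^sub>t \<one>\<^sub>t)),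
     (\<sigma>\<^sub>t, (Mult \<otimes>\<^sub>t \<one>\<^sub>t) \<cdot>\<^sub>t (\<one>\<^sub>t \<otimes>\<^sub>t Cup)),
     ((\<one>\<^sub>t \<otimes>\<^sub>t Cap) \<cdot>\<^sub>t (Swap \<otimes>\<^sub>t \<one>\<^sub>t), (Cap \<otimes>\<^sub>t \<one>\<^sub>t) \<cdot>\<^sub>t (\<one>\<^sub>t \<otimes>\<^sub>t Swap)),
     (Swap \<cdot>\<^sub>t Swap, \<one>\<^sub>t \<otimes>\<^sub>t \<one>\<^sub>t),
     ((Swap \<otimes>\<^sub>t \<one>\<^sub>t) \<cdot>\<^sub>t (\<one>\<^sub>t \<otimes>\<^sub>t Swap) \<cdot>\<^sub>t (Swap \<otimes>\<^sub>t \<one>\<^sub>t),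
      (\<one>\<^sub>t \<otimes>\<^sub>t Swap) \<cdot>\<^sub>t (Swap \<otimes>\<^sub>t \<one>\<^sub>t) \<cdot>\<^sub>t (\<one>\<^sub>t \<otimes>\<^sub>t Swap)),
     ((\<one>\<^sub>t \<otimes>\<^sub>t Mult) \<cdot>\<^sub>t (Swap \<otimes>\<^sub>t \<one>\<^sub>t) \<cdot>\<^sub>t (\<one>\<^sub>t \<otimes>\<^sub>t Swap), Swap \<cdot>\<^sub>t (Mult \<otimes>\<^sub>t \<one>\<^sub>t)),
     ((\<one>\<^sub>t \<otimes>\<^sub>t Swap) \<cdot>\<^sub>t (Swap \<otimes>\<^sub>t \<one>\<^sub>t) \<cdot>\<^sub>t (\<one>\<^sub>t \<otimes>\<^sub>t \<sigma>\<^sub>t), (\<sigma>\<^sub>t \<otimes>\<^sub>t \<one>\<^sub>t) \<cdot>\<^sub>t Swap),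
     (Cap \<cdot>\<^sub>t Swap, Cap),
     (Mult \<cdot>\<^sub>t Swap, - 1 *\<^sub>t Mult),
     (Mult \<cdot>\<^sub>t \<sigma>\<^sub>t, \<alpha> *\<^sub>t \<one>\<^sub>t),
     (Cap \<cdot>\<^sub>t Cup, \<delta> *\<^sub>t TId 0)}"

text \<open>The congruence generated by the defining relations and the axioms of a strict linear
  monoidal category.  The typing premises ensure that only parallel morphisms are related.\<close>

inductive tcong :: "'k::field \<Rightarrow> 'k \<Rightarrow> 'k tm \<Rightarrow> 'k tm \<Rightarrow> bool" for \<delta> \<alpha> where
  rel: "(t, u) \<in> defining_relations \<delta> \<alpha> \<Longrightarrow> tcong \<delta> \<alpha> t u"
| refl: "t : m \<rightarrow>\<^sub>t n \<Longrightarrow> tcong \<delta> \<alpha> t t"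
| sym: "tcong \<delta> \<alpha> t u \<Longrightarrow> tcong \<delta> \<alpha> u t"
| trans: "tcong \<delta> \<alpha> t u \<Longrightarrow> tcong \<delta> \<alpha> u v \<Longrightarrow> tcong \<delta> \<alpha> t v"
| comp_cong: "g : m \<rightarrow>\<^sub>t n \<Longrightarrow> f : l \<rightarrow>\<^sub>t m \<Longrightarrow> tcong \<delta> \<alpha> g g' \<Longrightarrow> tcong \<delta> \<alpha> f f' \<Longrightarrow>
    tcong \<delta> \<alpha> (g \<cdot>\<^sub>t f) (g' \<cdot>\<^sub>t f')"
| tens_cong: "tcong \<delta> \<alpha> f f' \<Longrightarrow> tcong \<delta> \<alpha> g g' \<Longrightarrow> tcong \<delta> \<alpha> (f \<otimes>\<^sub>t g) (f' \<otimes>\<^sub>t g')"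
| add_cong: "f : m \<rightarrow>\<^sub>t n \<Longrightarrow> g : m \<rightarrow>\<^sub>t n \<Longrightarrow> tcong \<delta> \<alpha> f f' \<Longrightarrow> tcong \<delta> \<alpha> g g' \<Longrightarrow>
    tcong \<delta> \<alpha> (f +\<^sub>t g) (f' +\<^sub>t g')"
| scale_cong: "tcong \<delta> \<alpha> f f' \<Longrightarrow> tcong \<delta> \<alpha> (c *\<^sub>t f) (c *\<^sub>t f')"
| add_assoc: "f : m \<rightarrow>\<^sub>t n \<Longrightarrow> g : m \<rightarrow>\<^sub>t n \<Longrightarrow> h : m \<rightarrow>\<^sub>t n \<Longrightarrow>
    tcong \<delta> \<alpha> ((f +\<^sub>t g) +\<^sub>t h) (f +\<^sub>t (g +\<^sub>t h))"
| add_comm: "f : m \<rightarrow>\<^sub>t n \<Longrightarrow> g : m \<rightarrow>\<^sub>t n \<Longrightarrow> tcong \<delta> \<alpha> (f +\<^sub>t g) (g +\<^sub>t f)"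
| add_zero: "f : m \<rightarrow>\<^sub>t n \<Longrightarrow> tcong \<delta> \<alpha> (TZero m n +\<^sub>t f) f"
| add_neg: "f : m \<rightarrow>\<^sub>t n \<Longrightarrow> tcong \<delta> \<alpha> (- 1 *\<^sub>t f +\<^sub>t f) (TZero m n)"
| scale_add_left: "f : m \<rightarrow>\<^sub>t n \<Longrightarrow> tcong \<delta> \<alpha> ((c + d) *\<^sub>t f) (c *\<^sub>t f +\<^sub>t d *\<^sub>t f)"
| scale_add_right: "f : m \<rightarrow>\<^sub>t n \<Longrightarrow> g : m \<rightarrow>\<^sub>t n \<Longrightarrow>
    tcong \<delta> \<alpha> (c *\<^sub>t (f +\<^sub>t g)) (c *\<^sub>t f +\<^sub>t c *\<^sub>t g)"
| scale_scale: "f : m \<rightarrow>\<^sub>t n \<Longrightarrow> tcong \<delta> \<alpha> ((c * d) *\<^sub>t f) (c *\<^sub>t d *\<^sub>t f)"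
| scale_one: "f : m \<rightarrow>\<^sub>t n \<Longrightarrow> tcong \<delta> \<alpha> (1 *\<^sub>t f) f"
| comp_assoc: "h : m \<rightarrow>\<^sub>t n \<Longrightarrow> g : l \<rightarrow>\<^sub>t m \<Longrightarrow> f : k \<rightarrow>\<^sub>t l \<Longrightarrow>
    tcong \<delta> \<alpha> ((h \<cdot>\<^sub>t g) \<cdot>\<^sub>t f) (h \<cdot>\<^sub>t (g \<cdot>\<^sub>t f))"
| id_comp: "f : m \<rightarrow>\<^sub>t n \<Longrightarrow> tcong \<delta> \<alpha> (TId n \<cdot>\<^sub>t f) f"
| comp_id: "f : m \<rightarrow>\<^sub>t n \<Longrightarrow> tcong \<delta> \<alpha> (f \<cdot>\<^sub>t TId m) f"
| comp_add_left: "g : m \<rightarrow>\<^sub>t n \<Longrightarrow> g' : m \<rightarrow>\<^sub>t n \<Longrightarrow> f : l \<rightarrow>\<^sub>t m \<Longrightarrow>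
    tcong \<delta> \<alpha> ((g +\<^sub>t g') \<cdot>\<^sub>t f) (g \<cdot>\<^sub>t f +\<^sub>t g' \<cdot>\<^sub>t f)"
| comp_add_right: "g : m \<rightarrow>\<^sub>t n \<Longrightarrow> f : l \<rightarrow>\<^sub>t m \<Longrightarrow> f' : l \<rightarrow>\<^sub>t m \<Longrightarrow>
    tcong \<delta> \<alpha> (g \<cdot>\<^sub>t (f +\<^sub>t f')) (g \<cdot>\<^sub>t f +\<^sub>t g \<cdot>\<^sub>t f')"
| comp_scale_left: "g : m \<rightarrow>\<^sub>t n \<Longrightarrow> f : l \<rightarrow>\<^sub>t m \<Longrightarrow>
    tcong \<delta> \<alpha> ((c *\<^sub>t g) \<cdot>\<^sub>t f) (c *\<^sub>t (g \<cdot>\<^sub>t f))"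
| comp_scale_right: "g : m \<rightarrow>\<^sub>t n \<Longrightarrow> f : l \<rightarrow>\<^sub>t m \<Longrightarrow>
    tcong \<delta> \<alpha> (g \<cdot>\<^sub>t (c *\<^sub>t f)) (c *\<^sub>t (g \<cdot>\<^sub>t f))"
| tens_add_left: "f : k \<rightarrow>\<^sub>t l \<Longrightarrow> f' : k \<rightarrow>\<^sub>t l \<Longrightarrow> g : m \<rightarrow>\<^sub>t n \<Longrightarrow>
    tcong \<delta> \<alpha> ((f +\<^sub>t f') \<otimes>\<^sub>t g) (f \<otimes>\<^sub>t g +\<^sub>t f' \<otimes>\<^sub>t g)"
| tens_add_right: "f : k \<rightarrow>\<^sub>t l \<Longrightarrow> g : m \<rightarrow>\<^sub>t n \<Longrightarrow> g' : m \<rightarrow>\<^sub>t n \<Longrightarrow>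
    tcong \<delta> \<alpha> (f \<otimes>\<^sub>t (g +\<^sub>t g')) (f \<otimes>\<^sub>t g +\<^sub>t f \<otimes>\<^sub>t g')"
| tens_scale_left: "f : k \<rightarrow>\<^sub>t l \<Longrightarrow> g : m \<rightarrow>\<^sub>t n \<Longrightarrow>
    tcong \<delta> \<alpha> ((c *\<^sub>t f) \<otimes>\<^sub>t g) (c *\<^sub>t (f \<otimes>\<^sub>t g))"
| tens_scale_right: "f : k \<rightarrow>\<^sub>t l \<Longrightarrow> g : m \<rightarrow>\<^sub>t n \<Longrightarrow>
    tcong \<delta> \<alpha> (f \<otimes>\<^sub>t (c *\<^sub>t g)) (c *\<^sub>t (f \<otimes>\<^sub>t g))"
| tens_assoc: "f : i \<rightarrow>\<^sub>t j \<Longrightarrow> g : k \<rightarrow>\<^sub>t l \<Longrightarrow> h : m \<rightarrow>\<^sub>t n \<Longrightarrow>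
    tcong \<delta> \<alpha> ((f \<otimes>\<^sub>t g) \<otimes>\<^sub>t h) (f \<otimes>\<^sub>t (g \<otimes>\<^sub>t h))"
| unit_tens: "f : m \<rightarrow>\<^sub>t n \<Longrightarrow> tcong \<delta> \<alpha> (TId 0 \<otimes>\<^sub>t f) f"
| tens_unit: "f : m \<rightarrow>\<^sub>t n \<Longrightarrow> tcong \<delta> \<alpha> (f \<otimes>\<^sub>t TId 0) f"
| tens_id: "tcong \<delta> \<alpha> (TId m \<otimes>\<^sub>t TId n) (TId (m + n))"
| interchange: "g : j \<rightarrow>\<^sub>t k \<Longrightarrow> f : i \<rightarrow>\<^sub>t j \<Longrightarrow> g' : m \<rightarrow>\<^sub>t n \<Longrightarrow> f' : l \<rightarrow>\<^sub>t m \<Longrightarrow>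
    tcong \<delta> \<alpha> ((g \<cdot>\<^sub>t f) \<otimes>\<^sub>t (g' \<cdot>\<^sub>t f')) ((g \<otimes>\<^sub>t g') \<cdot>\<^sub>t (f \<otimes>\<^sub>t f'))"

definition tclass :: "'k::field \<Rightarrow> 'k \<Rightarrow> 'k tm \<Rightarrow> 'k tm set" where
  "tclass \<delta> \<alpha> t = {u. tcong \<delta> \<alpha> t u}"

text \<open>\<open>braid1 n : 1 + n \<rightarrow> n + 1\<close> moves one strand past \<open>n\<close> strands, and
  \<open>braid m n : m + n \<rightarrow> n + m\<close> moves \<open>m\<close> strands past \<open>n\<close> strands;
  \<open>braid 1 1\<close> is congruent to \<open>Swap\<close>.\<close>

primrec braid1 :: "nat \<Rightarrow> 'k tm" where
  "braid1 0 = \<one>\<^sub>t"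
| "braid1 (Suc n) = (\<one>\<^sub>t \<otimes>\<^sub>t braid1 n) \<cdot>\<^sub>t (Swap \<otimes>\<^sub>t TId n)"

primrec braid :: "nat \<Rightarrow> nat \<Rightarrow> 'k tm" where
  "braid 0 n = TId n"
| "braid (Suc m) n = (braid1 n \<otimes>\<^sub>t TId m) \<cdot>\<^sub>t (\<one>\<^sub>t \<otimes>\<^sub>t braid m n)"

definition Tcat :: "'k::field \<Rightarrow> 'k \<Rightarrow> (nat, 'k tm set, 'k) monoidal_cat" where
  "Tcat \<delta> \<alpha> =
     \<lparr>Hom = (\<lambda>m n.
        \<lparr>carrier = {tclass \<delta> \<alpha> t | t. t : m \<rightarrow>\<^sub>t n}, mult = undefined, one = undefined,
         zero = tclass \<delta> \<alpha> (TZero m n),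
         add = (\<lambda>F G. \<Union>f \<in> F. \<Union>g \<in> G. tclass \<delta> \<alpha> (f +\<^sub>t g)),
         smult = (\<lambda>c F. \<Union>f \<in> F. tclass \<delta> \<alpha> (c *\<^sub>t f))\<rparr>),
      Idm = (\<lambda>n. tclass \<delta> \<alpha> (TId n)),
      cmp = (\<lambda>G F. \<Union>g \<in> G. \<Union>f \<in> F. tclass \<delta> \<alpha> (g \<cdot>\<^sub>t f)),
      Unit = 0,
      tob = (+),
      tmor = (\<lambda>F G. \<Union>f \<in> F. \<Union>g \<in> G. tclass \<delta> \<alpha> (f \<otimes>\<^sub>t g)),
      Braid = (\<lambda>m n. tclass \<delta> \<alpha> (braid m n))\<rparr>"

end

theory Submission
  imports Defs
begin

text \<open>Write \<open>\<mu>\<close>, \<open>s\<close>, \<open>\<eta>\<close>, \<open>\<epsilon>\<close> for the images of the generators in the quotient category and \<open>1\<close>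
  for the object \<open>X\<close>.  Both alternatives of the conclusion are linear relations among six
  morphisms \<open>3 \<rightarrow> 1\<close>: the three \<^emph>\<open>chords\<close>, in which a cap joins two of the inputs and the third
  input runs to the output, and the three \<^emph>\<open>trees\<close>, in which two of the inputs are multiplied
  and the product is then multiplied with the third.  The Jacobi identity is a relation among
  the trees alone, and the vector product identity expresses the sum of two trees by chords.

  Bending the third input round to the output is a linear map from morphisms \<open>3 \<rightarrow> 1\<close> to
  endomorphisms of \<open>2\<close>, and duality inverts it.  Hence a five-dimensional endomorphism space
  forces a nontrivial relation among the six diagrams (\<open>diagrams_dependent\<close>).  It remains to
  see that every such relation leads to one of the two identities
  (\<open>relation_space_dichotomy\<close>).

  The relations form a subspace \<open>N\<close> of \<open>k\<^sup>6\<close> on which the symmetric group \<open>S\<^sub>3\<close> acts by permuting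
  the inputs: chords are permuted, and trees, with suitable signs, are permuted up to the sign of
  the permutation.  Away from the characteristics 2 and 3 the chords span the trivial plus the standard
  representation, and the trees span the sign plus the standard representation, so one looks
  at the three types.
  \<^item> The trivial type would be the vanishing of the sum of the chords.  Closing two strands by a
    cup turns it into \<open>\<delta> + 2 = 0\<close>, which is excluded.
  \<^item> The sign type is the Jacobi identity.
  \<^item> The standard type is a relation between chords and trees with fixed coefficients
    \<open>p\<close> and \<open>w\<close>.  Closing excludes \<open>p = 0\<close>, because \<open>\<alpha> \<noteq> 0\<close>.  If \<open>w = 0\<close>, two chords agree, hence
    \<open>s\<close> is the identity and \<open>\<mu> = - \<mu>\<close>, against \<open>\<alpha> \<noteq> 0\<close>.  Otherwise it is the vector product
    identity for the cap rescaled by \<open>p / (3 * w)\<close>.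

  The proof of \<open>relation_space_dichotomy\<close> replaces the decomposition by explicit
  antisymmetrisation, which also covers characteristic 3: there \<open>\<delta> \<noteq> - 2\<close> says \<open>\<delta> \<noteq> 1\<close>, and
  closing then gives \<open>p = 0\<close> and leaves the Jacobi identity.

  The diagrammatic part takes place in an arbitrary linear strict monoidal category on the
  natural numbers with generating morphisms as in the locale \<open>trivalent\<close>.  The category given by
  generators and relations is such a category, and the structure passes to quotients by tensor
  ideals.\<close>

section \<open>Vector spaces: dependent families and quotients\<close>

text \<open>A family may repeat a vector, which the set-based notion of linear dependence does not
  see; a repetition gives the relation with coefficients \<open>1\<close> and \<open>- 1\<close>.\<close>

lemma (in vectorspace) family_dependent:
  assumes fin: "fin_dim" and "dim < n" and x: "\<And>i. i < n \<Longrightarrow> x i \<in> carrier V"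
  obtains c where "\<And>i. c i \<in> carrier K" "(\<Oplus>\<^bsub>V\<^esub>i\<in>{..<n}. c i \<odot>\<^bsub>V\<^esub> x i) = \<zero>\<^bsub>V\<^esub>"
    "\<exists>i<n. c i \<noteq> \<zero>\<^bsub>K\<^esub>"
proof (cases "inj_on x {..<n}")
  case True
  have sub: "x ` {..<n} \<subseteq> carrier V" using x by auto
  have "card (x ` {..<n}) = n" using True by (simp add: card_image)
  then have "lin_dep (x ` {..<n})" using li_le_dim(2)[OF fin sub] \<open>dim < n\<close> by linarith
  then obtain a v where a: "a \<in> x ` {..<n} \<rightarrow> carrier K" "lincomb a (x ` {..<n}) = \<zero>\<^bsub>V\<^esub>"
    "v \<in> x ` {..<n}" "a v \<noteq> \<zero>\<^bsub>K\<^esub>"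
    using finite_lin_dep[OF _ _ sub] by (metis finite_imageI finite_lessThan)
  define c where "c i = (if i < n then a (x i) else \<zero>\<^bsub>K\<^esub>)" for i
  have "(\<Oplus>\<^bsub>V\<^esub>i\<in>{..<n}. c i \<odot>\<^bsub>V\<^esub> x i) = (\<Oplus>\<^bsub>V\<^esub>i\<in>{..<n}. a (x i) \<odot>\<^bsub>V\<^esub> x i)"
    by (rule finsum_cong') (use a(1) x in \<open>auto simp: c_def\<close>)
  also have "\<dots> = lincomb a (x ` {..<n})"
    unfolding lincomb_def by (subst finsum_reindex) (use a(1) x True in auto)
  finally show thesis using a by (intro that[of c]) (auto simp: c_def)
next
  case False
  then obtain i j where ij: "i < n" "j < n" "i \<noteq> j" "x i = x j" by (auto simp: inj_on_def)
  define c where "c k = (if k = i then \<one>\<^bsub>K\<^esub> else if k = j then \<ominus>\<^bsub>K\<^esub> \<one>\<^bsub>K\<^esub> else \<zero>\<^bsub>K\<^esub>)" for k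
  have c: "c k \<in> carrier K" for k by (simp add: c_def)
  have "{..<n} = insert i (insert j ({..<n} - {i, j}))" using ij by auto
  then have "(\<Oplus>\<^bsub>V\<^esub>k\<in>{..<n}. c k \<odot>\<^bsub>V\<^esub> x k)
      = (\<Oplus>\<^bsub>V\<^esub>k\<in>insert i (insert j ({..<n} - {i, j})). c k \<odot>\<^bsub>V\<^esub> x k)" by simp
  also have "\<dots> = c i \<odot>\<^bsub>V\<^esub> x i \<oplus>\<^bsub>V\<^esub> (c j \<odot>\<^bsub>V\<^esub> x j \<oplus>\<^bsub>V\<^esub>
      (\<Oplus>\<^bsub>V\<^esub>k\<in>{..<n} - {i, j}. c k \<odot>\<^bsub>V\<^esub> x k))"
    using ij x c by (subst finsum_insert, auto)+
  also have "(\<Oplus>\<^bsub>V\<^esub>k\<in>{..<n} - {i, j}. c k \<odot>\<^bsub>V\<^esub> x k) = (\<Oplus>\<^bsub>V\<^esub>k\<in>{..<n} - {i, j}. \<zero>\<^bsub>V\<^esub>)"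
    by (rule finsum_cong') (use x in \<open>auto simp: c_def\<close>)
  also have "\<dots> = \<zero>\<^bsub>V\<^esub>" by simp
  also have "c i \<odot>\<^bsub>V\<^esub> x i \<oplus>\<^bsub>V\<^esub> (c j \<odot>\<^bsub>V\<^esub> x j \<oplus>\<^bsub>V\<^esub> \<zero>\<^bsub>V\<^esub>) = \<zero>\<^bsub>V\<^esub>"
    using ij x by (simp add: c_def smult_l_minus M.r_neg)
  finally show thesis using ij c by (intro that[of c]) (auto simp: c_def)
qed

text \<open>Every module axiom for \<open>N\<close> is the image under \<open>q\<close> of the same axiom for \<open>M\<close>.\<close>

lemma module_image:
  assumes "module R M"
    and carr: "carrier N = q ` carrier M" and zero: "\<zero>\<^bsub>N\<^esub> = q \<zero>\<^bsub>M\<^esub>"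
    and add: "\<And>x y. x \<in> carrier M \<Longrightarrow> y \<in> carrier M \<Longrightarrow> q x \<oplus>\<^bsub>N\<^esub> q y = q (x \<oplus>\<^bsub>M\<^esub> y)"
    and smult: "\<And>c x. c \<in> carrier R \<Longrightarrow> x \<in> carrier M \<Longrightarrow> c \<odot>\<^bsub>N\<^esub> q x = q (c \<odot>\<^bsub>M\<^esub> x)"
  shows "module R N"
proof -
  interpret Module.module R M by fact
  show ?thesis
  proof (rule moduleI[OF R.is_cring abelian_groupI])
    fix x assume "x \<in> carrier N"
    then obtain u where u: "u \<in> carrier M" "x = q u" by (auto simp: carr)
    have "q (\<ominus>\<^bsub>M\<^esub> u) \<in> carrier N" using u carr by blast
    moreover have "q (\<ominus>\<^bsub>M\<^esub> u) \<oplus>\<^bsub>N\<^esub> x = \<zero>\<^bsub>N\<^esub>" using u by (simp add: add zero M.l_neg)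
    ultimately show "\<exists>y\<in>carrier N. y \<oplus>\<^bsub>N\<^esub> x = \<zero>\<^bsub>N\<^esub>" by blast
  qed (auto simp: carr zero add smult M.a_ac smult_l_distr smult_r_distr smult_assoc1)
qed

locale module_quotient =
  fixes R :: "'k ring" and M :: "('k, 'm) module" and W :: "'m set"
  assumes submodule: "submodule R W M"
begin

interpretation W: LinearCombinations.submodule R W M by (rule submodule)

lemma ambient_module: "module R M" by (rule W.module)

interpretation M: Module.module R M by (rule ambient_module)

lemma abelian_subgroup_quotient: "abelian_subgroup W M"
proof -
  have inv: "\<ominus>\<^bsub>M\<^esub> x \<in> W" if "x \<in> W" for x
  proof -
    have "\<ominus>\<^bsub>R\<^esub> \<one>\<^bsub>R\<^esub> \<odot>\<^bsub>M\<^esub> x \<in> W" using that by simp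
    moreover have "x \<in> carrier M" using that W.subset by blast
    ultimately show ?thesis by (simp add: M.smult_l_minus)
  qed
  have "W \<noteq> {}" using W.zero_closed by blast
  then have "subgroup W (add_monoid M)"
    by (intro M.add.subgroupI) (use inv W.subset in \<open>auto simp: a_inv_def\<close>)
  then show ?thesis
    by (intro abelian_subgroupI3 additive_subgroup.intro M.abelian_group_axioms)
qed

interpretation W: abelian_subgroup W M by (rule abelian_subgroup_quotient)

lemma mem_coset_iff:
  assumes "x \<in> carrier M"
  shows "y \<in> W +>\<^bsub>M\<^esub> x \<longleftrightarrow> y \<in> carrier M \<and> y \<ominus>\<^bsub>M\<^esub> x \<in> W"
  using W.a_rcos_module[OF assms] W.a_elemrcos_carrier[OF assms] by (auto simp: M.minus_eq)

lemma coset_eq_iff: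
  assumes "x \<in> carrier M" "y \<in> carrier M"
  shows "W +>\<^bsub>M\<^esub> x = W +>\<^bsub>M\<^esub> y \<longleftrightarrow> x \<ominus>\<^bsub>M\<^esub> y \<in> W"
proof -
  have "W +>\<^bsub>M\<^esub> x = W +>\<^bsub>M\<^esub> y \<longleftrightarrow> x \<in> W +>\<^bsub>M\<^esub> y"
    using W.a_rcos_self[OF assms(1)] W.a_repr_independence'[of x y] assms by blast
  then show ?thesis using assms by (simp add: mem_coset_iff)
qed

lemma quotient_add:
  assumes "x \<in> carrier M" "y \<in> carrier M"
  shows "(W +>\<^bsub>M\<^esub> x) \<oplus>\<^bsub>quotient_space M W\<^esub> (W +>\<^bsub>M\<^esub> y) = W +>\<^bsub>M\<^esub> (x \<oplus>\<^bsub>M\<^esub> y)"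
  using assms by (simp add: quotient_space_def W.a_rcos_sum)

text \<open>The scalar multiple of a coset is defined as a union over all representatives; any two of
  them differ by an element of \<open>W\<close>, so all cosets in the union agree.\<close>

lemma quotient_smult:
  assumes "c \<in> carrier R" "x \<in> carrier M"
  shows "c \<odot>\<^bsub>quotient_space M W\<^esub> (W +>\<^bsub>M\<^esub> x) = W +>\<^bsub>M\<^esub> (c \<odot>\<^bsub>M\<^esub> x)"
proof -
  have const: "W +>\<^bsub>M\<^esub> (c \<odot>\<^bsub>M\<^esub> y) = W +>\<^bsub>M\<^esub> (c \<odot>\<^bsub>M\<^esub> x)" if "y \<in> W +>\<^bsub>M\<^esub> x" for y
  proof -
    have y: "y \<in> carrier M" "y \<ominus>\<^bsub>M\<^esub> x \<in> W" using that assms by (simp_all add: mem_coset_iff)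
    have "c \<odot>\<^bsub>M\<^esub> y \<ominus>\<^bsub>M\<^esub> c \<odot>\<^bsub>M\<^esub> x = c \<odot>\<^bsub>M\<^esub> (y \<ominus>\<^bsub>M\<^esub> x)"
      using y assms by (simp add: M.minus_eq M.smult_r_distr M.smult_r_minus)
    also have "\<dots> \<in> W" using y assms by simp
    finally show ?thesis using y assms by (simp add: coset_eq_iff)
  qed
  have "(\<Union>y \<in> W +>\<^bsub>M\<^esub> x. W +>\<^bsub>M\<^esub> (c \<odot>\<^bsub>M\<^esub> y)) = W +>\<^bsub>M\<^esub> (c \<odot>\<^bsub>M\<^esub> x)"
    by (rule SUP_eq_const[OF _ const]) (use W.a_rcos_self[OF assms(2)] in blast)
  then show ?thesis by (simp add: quotient_space_def)
qed

lemma quotient_carrier: "carrier (quotient_space M W) = (\<lambda>x. W +>\<^bsub>M\<^esub> x) ` carrier M"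
  by (auto simp: quotient_space_def A_RCOSETS_def')

lemma quotient_zero: "\<zero>\<^bsub>quotient_space M W\<^esub> = W +>\<^bsub>M\<^esub> \<zero>\<^bsub>M\<^esub>"
  using W.subset by (simp add: quotient_space_def)

lemma quotient_module: "module R (quotient_space M W)"
  by (rule module_image[OF ambient_module quotient_carrier quotient_zero])
    (simp_all add: quotient_add quotient_smult)

end

section \<open>Linear strict monoidal categories on the natural numbers\<close>

abbreviation linear_maps ::
    "('k::field, 'm) module \<Rightarrow> ('k, 'n) module \<Rightarrow> ('m \<Rightarrow> 'n) set" where
  "linear_maps M N \<equiv> LinearCombinations.module_hom class_ring M N"

lemmas linear_maps_def = LinearCombinations.module_hom_def

text \<open>The object \<open>n\<close> stands for the \<open>n\<close>-th tensor power of a generating object, so the tensor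
  product of objects is addition; such a category is often called a PRO.  Bilinearity of
  composition and tensor product is stated as linearity in each argument, which includes
  closure under the operations.  Disjointness of the hom-spaces makes source and target
  functions of a morphism.\<close>

locale linear_pro =
  fixes C :: "(nat, 'm, 'k::field) monoidal_cat" (structure)
  assumes unit_ob: "\<u> = 0"
    and tensor_ob: "tob C = (+)"
    and hom_module: "module class_ring (Hom C m n)"
    and hom_disjoint: "f \<in> carrier (Hom C m n) \<Longrightarrow> f \<in> carrier (Hom C m' n') \<Longrightarrow> m = m' \<and> n = n'"
    and id_hom: "\<i> n \<in> carrier (Hom C n n)"
    and comp_left_linear: "g \<in> carrier (Hom C m n) \<Longrightarrow>
      (\<lambda>f. g \<cdot> f) \<in> linear_maps (Hom C l m) (Hom C l n)"
    and comp_right_linear: "f \<in> carrier (Hom C l m) \<Longrightarrow>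
      (\<lambda>g. g \<cdot> f) \<in> linear_maps (Hom C m n) (Hom C l n)"
    and tens_left_linear: "f \<in> carrier (Hom C k l) \<Longrightarrow>
      (\<lambda>g. f \<otimes>\<^sub>m g) \<in> linear_maps (Hom C m n) (Hom C (k + m) (l + n))"
    and tens_right_linear: "g \<in> carrier (Hom C m n) \<Longrightarrow>
      (\<lambda>f. f \<otimes>\<^sub>m g) \<in> linear_maps (Hom C k l) (Hom C (k + m) (l + n))"
    and hom_comp_assoc: "h \<in> carrier (Hom C m n) \<Longrightarrow> g \<in> carrier (Hom C l m) \<Longrightarrow>
      f \<in> carrier (Hom C k l) \<Longrightarrow> (h \<cdot> g) \<cdot> f = h \<cdot> (g \<cdot> f)"
    and hom_id_comp: "f \<in> carrier (Hom C m n) \<Longrightarrow> \<i> n \<cdot> f = f"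
    and hom_comp_id: "f \<in> carrier (Hom C m n) \<Longrightarrow> f \<cdot> \<i> m = f"
    and hom_tens_assoc: "f \<in> carrier (Hom C i j) \<Longrightarrow> g \<in> carrier (Hom C k l) \<Longrightarrow>
      h \<in> carrier (Hom C m n) \<Longrightarrow> (f \<otimes>\<^sub>m g) \<otimes>\<^sub>m h = f \<otimes>\<^sub>m (g \<otimes>\<^sub>m h)"
    and hom_unit_tens: "f \<in> carrier (Hom C m n) \<Longrightarrow> \<i> 0 \<otimes>\<^sub>m f = f"
    and hom_tens_unit: "f \<in> carrier (Hom C m n) \<Longrightarrow> f \<otimes>\<^sub>m \<i> 0 = f"
    and tens_id: "\<i> m \<otimes>\<^sub>m \<i> n = \<i> (m + n)"
    and hom_interchange: "g \<in> carrier (Hom C j k) \<Longrightarrow> f \<in> carrier (Hom C i j) \<Longrightarrow>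
      g' \<in> carrier (Hom C m n) \<Longrightarrow> f' \<in> carrier (Hom C l m) \<Longrightarrow>
      (g \<cdot> f) \<otimes>\<^sub>m (g' \<cdot> f') = (g \<otimes>\<^sub>m g') \<cdot> (f \<otimes>\<^sub>m f')"
begin

sublocale hom: Module.module class_ring "Hom C m n" for m n
  by (rule hom_module)

lemma comp_hom: "g \<in> carrier (Hom C m n) \<Longrightarrow> f \<in> carrier (Hom C l m) \<Longrightarrow>
    g \<cdot> f \<in> carrier (Hom C l n)"
  using comp_left_linear by (fastforce simp: linear_maps_def)

lemma tens_hom: "f \<in> carrier (Hom C k l) \<Longrightarrow> g \<in> carrier (Hom C m n) \<Longrightarrow>
    f \<otimes>\<^sub>m g \<in> carrier (Hom C (k + m) (l + n))"
  using tens_left_linear by (fastforce simp: linear_maps_def)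

lemma module_hom_minus:
  assumes "F \<in> linear_maps (Hom C k l) (Hom C m n)"
    "f \<in> carrier (Hom C k l)" "g \<in> carrier (Hom C k l)"
  shows "F (f \<ominus>\<^bsub>Hom C k l\<^esub> g) = F f \<ominus>\<^bsub>Hom C m n\<^esub> F g"
proof -
  interpret mod_hom class_ring "Hom C k l" "Hom C m n" F
    by unfold_locales (rule assms(1))
  show ?thesis using assms by simp
qed

end

section \<open>Quotients by tensor ideals\<close>

locale linear_pro_ideal = linear_pro C for C :: "(nat, 'm, 'k::field) monoidal_cat" (structure) +
  fixes I :: "nat \<Rightarrow> nat \<Rightarrow> 'm set"
  assumes ideal: "tensor_ideal C I"
begin

abbreviation proj :: "'m \<Rightarrow> 'm set" (\<open>\<pi>\<close>) where "\<pi> \<equiv> ideal_coset C I"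

abbreviation Q :: "(nat, 'm set, 'k) monoidal_cat" where "Q \<equiv> quotient_cat C I"

lemma ideal_submodule: "submodule class_ring (I m n) (Hom C m n)"
  using ideal by (auto simp: tensor_ideal_def subspace_def)

sublocale quot: module_quotient class_ring "Hom C m n" "I m n" for m n
  by (rule module_quotient.intro) (rule ideal_submodule)

lemma ideal_comp_left: "f \<in> I l m \<Longrightarrow> g \<in> carrier (Hom C m n) \<Longrightarrow> g \<cdot> f \<in> I l n"
  and ideal_comp_right: "g \<in> I m n \<Longrightarrow> f \<in> carrier (Hom C l m) \<Longrightarrow> g \<cdot> f \<in> I l n"
  and ideal_tens_id: "f \<in> I m n \<Longrightarrow> f \<otimes>\<^sub>m \<i> k \<in> I (m + k) (n + k)"
  and ideal_id_tens: "f \<in> I m n \<Longrightarrow> \<i> k \<otimes>\<^sub>m f \<in> I (k + m) (k + n)"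
  using ideal unfolding tensor_ideal_def tensor_ob by blast+

lemma ideal_hom: "f \<in> I m n \<Longrightarrow> f \<in> carrier (Hom C m n)"
  using ideal_submodule by (meson LinearCombinations.submodule.subset subsetD)

text \<open>A tensor ideal is only required to absorb tensor products with identities; the general
  case follows by factoring \<open>f \<otimes>\<^sub>m g\<close> into two layers.\<close>

lemma ideal_tens_right:
  assumes "f \<in> I k l" "g \<in> carrier (Hom C m n)"
  shows "f \<otimes>\<^sub>m g \<in> I (k + m) (l + n)"
proof -
  have "f \<otimes>\<^sub>m g = (f \<cdot> \<i> k) \<otimes>\<^sub>m (\<i> n \<cdot> g)"
    using assms by (simp add: hom_comp_id[OF ideal_hom] hom_id_comp)
  also have "\<dots> = (f \<otimes>\<^sub>m \<i> n) \<cdot> (\<i> k \<otimes>\<^sub>m g)"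
    by (rule hom_interchange[OF ideal_hom id_hom id_hom]) (use assms in auto)
  also have "\<dots> \<in> I (k + m) (l + n)"
    by (rule ideal_comp_right[OF ideal_tens_id tens_hom[OF id_hom]]) (use assms in auto)
  finally show ?thesis .
qed

lemma ideal_tens_left:
  assumes "f \<in> carrier (Hom C k l)" "g \<in> I m n"
  shows "f \<otimes>\<^sub>m g \<in> I (k + m) (l + n)"
proof -
  have "f \<otimes>\<^sub>m g = (f \<cdot> \<i> k) \<otimes>\<^sub>m (\<i> n \<cdot> g)"
    using assms by (simp add: hom_id_comp[OF ideal_hom] hom_comp_id)
  also have "\<dots> = (f \<otimes>\<^sub>m \<i> n) \<cdot> (\<i> k \<otimes>\<^sub>m g)"
    by (rule hom_interchange[OF _ id_hom id_hom ideal_hom]) (use assms in auto)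
  also have "\<dots> \<in> I (k + m) (l + n)"
    by (rule ideal_comp_left[OF ideal_id_tens tens_hom[OF _ id_hom]]) (use assms in auto)
  finally show ?thesis .
qed

lemma proj_eq: "f \<in> carrier (Hom C m n) \<Longrightarrow> \<pi> f = I m n +>\<^bsub>Hom C m n\<^esub> f"
  unfolding ideal_coset_def using hom_disjoint by blast

lemma proj_eq_iff: "f \<in> carrier (Hom C m n) \<Longrightarrow> g \<in> carrier (Hom C m n) \<Longrightarrow>
    \<pi> f = \<pi> g \<longleftrightarrow> f \<ominus>\<^bsub>Hom C m n\<^esub> g \<in> I m n"
  by (simp add: proj_eq quot.coset_eq_iff)

lemma mem_proj_iff: "f \<in> carrier (Hom C m n) \<Longrightarrow>
    g \<in> \<pi> f \<longleftrightarrow> g \<in> carrier (Hom C m n) \<and> \<pi> g = \<pi> f"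
  by (metis proj_eq proj_eq_iff quot.mem_coset_iff)

lemma proj_self: "f \<in> carrier (Hom C m n) \<Longrightarrow> f \<in> \<pi> f"
  by (simp add: mem_proj_iff)

lemma quotient_hom: "Hom Q m n = quotient_space (Hom C m n) (I m n)"
  by (simp add: quotient_cat_def)

lemma quotient_hom_carrier: "carrier (Hom Q m n) = \<pi> ` carrier (Hom C m n)"
  by (simp add: quotient_hom quot.quotient_carrier proj_eq)

lemma proj_hom: "f \<in> carrier (Hom C m n) \<Longrightarrow> \<pi> f \<in> carrier (Hom Q m n)"
  by (simp add: quotient_hom_carrier)

text \<open>The two factors are changed one after the other, each time by an element of the ideal.\<close>

lemma proj_comp:
  assumes g: "g \<in> carrier (Hom C m n)" and f: "f \<in> carrier (Hom C l m)"
  shows "\<pi> g \<cdot>\<^bsub>Q\<^esub> \<pi> f = \<pi> (g \<cdot> f)"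
proof -
  have eq: "\<pi> (g' \<cdot> f') = \<pi> (g \<cdot> f)" if "g' \<in> \<pi> g" "f' \<in> \<pi> f" for g' f'
  proof -
    have g': "g' \<in> carrier (Hom C m n)" "g' \<ominus>\<^bsub>Hom C m n\<^esub> g \<in> I m n"
      and f': "f' \<in> carrier (Hom C l m)" "f' \<ominus>\<^bsub>Hom C l m\<^esub> f \<in> I l m"
      using that g f by (auto simp: mem_proj_iff proj_eq_iff)
    have "g' \<cdot> f' \<ominus>\<^bsub>Hom C l n\<^esub> g' \<cdot> f \<in> I l n"
      using ideal_comp_left[OF f'(2) g'(1)]
      by (simp add: module_hom_minus[OF comp_left_linear[OF g'(1)] f'(1) f])
    then have "\<pi> (g' \<cdot> f') = \<pi> (g' \<cdot> f)"
      using g'(1) f'(1) f by (subst proj_eq_iff[of _ l n]) (auto intro: comp_hom)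
    moreover have "g' \<cdot> f \<ominus>\<^bsub>Hom C l n\<^esub> g \<cdot> f \<in> I l n"
      using ideal_comp_right[OF g'(2) f]
      by (simp add: module_hom_minus[OF comp_right_linear[OF f] g'(1) g])
    then have "\<pi> (g' \<cdot> f) = \<pi> (g \<cdot> f)"
      using g'(1) g f by (subst proj_eq_iff[of _ l n]) (auto intro: comp_hom)
    ultimately show ?thesis by simp
  qed
  have "(\<Union>g' \<in> \<pi> g. \<Union>f' \<in> \<pi> f. \<pi> (g' \<cdot> f')) = \<pi> (g \<cdot> f)"
    by (rule SUP_eq_const[OF _ SUP_eq_const[OF _ eq]])
      (use proj_self[OF g] proj_self[OF f] in blast)+
  then show ?thesis by (simp add: quotient_cat_def)
qed

lemma proj_tens:
  assumes f: "f \<in> carrier (Hom C k l)" and g: "g \<in> carrier (Hom C m n)"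
  shows "\<pi> f \<otimes>\<^sub>m\<^bsub>Q\<^esub> \<pi> g = \<pi> (f \<otimes>\<^sub>m g)"
proof -
  have eq: "\<pi> (f' \<otimes>\<^sub>m g') = \<pi> (f \<otimes>\<^sub>m g)" if "f' \<in> \<pi> f" "g' \<in> \<pi> g" for f' g'
  proof -
    have g': "g' \<in> carrier (Hom C m n)" "g' \<ominus>\<^bsub>Hom C m n\<^esub> g \<in> I m n"
      and f': "f' \<in> carrier (Hom C k l)" "f' \<ominus>\<^bsub>Hom C k l\<^esub> f \<in> I k l"
      using that g f by (auto simp: mem_proj_iff proj_eq_iff)
    have "f' \<otimes>\<^sub>m g' \<ominus>\<^bsub>Hom C (k + m) (l + n)\<^esub> f' \<otimes>\<^sub>m g \<in> I (k + m) (l + n)"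
      using ideal_tens_left[OF f'(1) g'(2)]
      by (simp add: module_hom_minus[OF tens_left_linear[OF f'(1)] g'(1) g])
    then have "\<pi> (f' \<otimes>\<^sub>m g') = \<pi> (f' \<otimes>\<^sub>m g)"
      using g'(1) f'(1) g by (subst proj_eq_iff[of _ "k + m" "l + n"]) (auto intro: tens_hom)
    moreover have "f' \<otimes>\<^sub>m g \<ominus>\<^bsub>Hom C (k + m) (l + n)\<^esub> f \<otimes>\<^sub>m g \<in> I (k + m) (l + n)"
      using ideal_tens_right[OF f'(2) g]
      by (simp add: module_hom_minus[OF tens_right_linear[OF g] f'(1) f])
    then have "\<pi> (f' \<otimes>\<^sub>m g) = \<pi> (f \<otimes>\<^sub>m g)"
      using f'(1) g f by (subst proj_eq_iff[of _ "k + m" "l + n"]) (auto intro: tens_hom)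
    ultimately show ?thesis by simp
  qed
  have "(\<Union>f' \<in> \<pi> f. \<Union>g' \<in> \<pi> g. \<pi> (f' \<otimes>\<^sub>m g')) = \<pi> (f \<otimes>\<^sub>m g)"
    by (rule SUP_eq_const[OF _ SUP_eq_const[OF _ eq]])
      (use proj_self[OF g] proj_self[OF f] in blast)+
  then show ?thesis by (simp add: quotient_cat_def)
qed

lemma proj_id: "\<i>\<^bsub>Q\<^esub> n = \<pi> (\<i> n)"
  by (simp add: quotient_cat_def)

lemma proj_add: "f \<in> carrier (Hom C m n) \<Longrightarrow> g \<in> carrier (Hom C m n) \<Longrightarrow>
    \<pi> f \<oplus>\<^bsub>Hom Q m n\<^esub> \<pi> g = \<pi> (f \<oplus>\<^bsub>Hom C m n\<^esub> g)"
  by (simp add: proj_eq[of _ m n] quotient_hom quot.quotient_add)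

lemma proj_smult: "f \<in> carrier (Hom C m n) \<Longrightarrow>
    c \<odot>\<^bsub>Hom Q m n\<^esub> \<pi> f = \<pi> (c \<odot>\<^bsub>Hom C m n\<^esub> f)"
  by (simp add: proj_eq[of _ m n] quotient_hom quot.quotient_smult)

lemma module_hom_quotient:
  assumes F: "F \<in> linear_maps (Hom C k l) (Hom C m n)"
    and G: "\<And>f. f \<in> carrier (Hom C k l) \<Longrightarrow> G (\<pi> f) = \<pi> (F f)"
  shows "G \<in> linear_maps (Hom Q k l) (Hom Q m n)"
proof -
  note F' = LinearCombinations.module_hom_closed[OF F] LinearCombinations.module_hom_add[OF F]
    LinearCombinations.module_hom_smult[OF F]
  then show ?thesis
    unfolding linear_maps_def quotient_hom_carrier
    by (auto simp: G proj_add proj_smult Pi_iff)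
qed

text \<open>The projection is surjective on hom-spaces and commutes with all operations, so every
  axiom descends.\<close>

theorem quotient_linear_pro: "linear_pro Q"
proof (rule linear_pro.intro)
  show "\<u>\<^bsub>Q\<^esub> = 0" "tob Q = (+)" by (simp_all add: quotient_cat_def unit_ob tensor_ob)
  show "module class_ring (Hom Q m n)" for m n
    unfolding quotient_hom by (rule quot.quotient_module)
  show "m = m' \<and> n = n'" if "f \<in> carrier (Hom Q m n)" "f \<in> carrier (Hom Q m' n')" for f m n m' n'
    using that hom_disjoint by (auto simp: quotient_hom_carrier) (metis mem_proj_iff)+
  show "\<i>\<^bsub>Q\<^esub> n \<in> carrier (Hom Q n n)" for n by (simp add: proj_id proj_hom id_hom)
  show "(\<lambda>f. g \<cdot>\<^bsub>Q\<^esub> f) \<in> linear_maps (Hom Q l m) (Hom Q l n)"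
    if "g \<in> carrier (Hom Q m n)" for g l m n
    using that
    by (auto simp: quotient_hom_carrier proj_comp intro!: module_hom_quotient[OF comp_left_linear])
  show "(\<lambda>g. g \<cdot>\<^bsub>Q\<^esub> f) \<in> linear_maps (Hom Q m n) (Hom Q l n)"
    if "f \<in> carrier (Hom Q l m)" for f l m n
    using that
    by (auto simp: quotient_hom_carrier proj_comp intro!: module_hom_quotient[OF comp_right_linear])
  show "(\<lambda>g. f \<otimes>\<^sub>m\<^bsub>Q\<^esub> g) \<in> linear_maps (Hom Q m n) (Hom Q (k + m) (l + n))"
    if "f \<in> carrier (Hom Q k l)" for f k l m n
    using that
    by (auto simp: quotient_hom_carrier proj_tens intro!: module_hom_quotient[OF tens_left_linear])
  show "(\<lambda>f. f \<otimes>\<^sub>m\<^bsub>Q\<^esub> g) \<in> linear_maps (Hom Q k l) (Hom Q (k + m) (l + n))"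
    if "g \<in> carrier (Hom Q m n)" for g k l m n
    using that
    by (auto simp: quotient_hom_carrier proj_tens intro!: module_hom_quotient[OF tens_right_linear])
qed (auto simp: quotient_hom_carrier proj_id tens_id id_hom
    proj_comp[OF comp_hom] proj_comp[OF _ comp_hom] proj_comp proj_tens
    proj_tens[OF tens_hom] proj_tens[OF _ tens_hom] hom_comp_assoc
    proj_comp[OF id_hom] proj_comp[OF _ id_hom] hom_id_comp hom_comp_id
    proj_tens[OF id_hom id_hom] proj_tens[OF id_hom] proj_tens[OF _ id_hom] hom_unit_tens
    hom_tens_unit hom_tens_assoc
    proj_tens[OF comp_hom comp_hom] proj_comp[OF tens_hom tens_hom] hom_interchange)

end

section \<open>Diagram calculus\<close>

context linear_pro
begin

text \<open>With source and target as functions, composability becomes an arithmetic side condition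
  that the simplifier discharges.  The rules below bring a diagram into a composite, associated
  to the right, of layers \<open>\<i> a \<otimes>\<^sub>m (g \<otimes>\<^sub>m \<i> b)\<close>, that is, into a word of generators with the number
  of idle strands on either side.\<close>

definition arr :: "'m \<Rightarrow> bool" where "arr f \<longleftrightarrow> (\<exists>m n. f \<in> carrier (Hom C m n))"
definition src :: "'m \<Rightarrow> nat" where "src f = (THE m. \<exists>n. f \<in> carrier (Hom C m n))"
definition tgt :: "'m \<Rightarrow> nat" where "tgt f = (THE n. \<exists>m. f \<in> carrier (Hom C m n))"

lemma hom_iff: "f \<in> carrier (Hom C m n) \<longleftrightarrow> arr f \<and> src f = m \<and> tgt f = n"
proof -
  have *: "src f = m \<and> tgt f = n" if "f \<in> carrier (Hom C m n)" for m n
    using that hom_disjoint unfolding src_def tgt_def by (blast intro: the_equality)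
  then show ?thesis unfolding arr_def by metis
qed

lemma arr_hom: "arr f \<Longrightarrow> f \<in> carrier (Hom C (src f) (tgt f))"
  by (simp add: hom_iff)

lemma id_arr [simp]: "arr (\<i> n)" "src (\<i> n) = n" "tgt (\<i> n) = n"
  using id_hom by (auto simp: hom_iff)

lemma comp_arr [simp]:
  assumes "arr g" "arr f" "src g = tgt f"
  shows "arr (g \<cdot> f)" "src (g \<cdot> f) = src f" "tgt (g \<cdot> f) = tgt g"
  using comp_hom[OF arr_hom[OF assms(1)], of f "src f"] assms by (auto simp: hom_iff)

lemma tens_arr [simp]:
  assumes "arr f" "arr g"
  shows "arr (f \<otimes>\<^sub>m g)" "src (f \<otimes>\<^sub>m g) = src f + src g" "tgt (f \<otimes>\<^sub>m g) = tgt f + tgt g"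
  using tens_hom[OF assms[THEN arr_hom]] by (auto simp: hom_iff)

lemma comp_assoc [simp]: "arr h \<Longrightarrow> arr g \<Longrightarrow> arr f \<Longrightarrow> src h = tgt g \<Longrightarrow> src g = tgt f \<Longrightarrow>
    (h \<cdot> g) \<cdot> f = h \<cdot> (g \<cdot> f)"
  by (rule hom_comp_assoc) (auto simp: hom_iff)

lemma id_comp [simp]: "arr f \<Longrightarrow> tgt f = n \<Longrightarrow> \<i> n \<cdot> f = f"
  by (rule hom_id_comp) (auto simp: hom_iff)

lemma comp_id [simp]: "arr f \<Longrightarrow> src f = m \<Longrightarrow> f \<cdot> \<i> m = f"
  by (rule hom_comp_id) (auto simp: hom_iff)

lemma tens_assoc [simp]: "arr f \<Longrightarrow> arr g \<Longrightarrow> arr h \<Longrightarrow> (f \<otimes>\<^sub>m g) \<otimes>\<^sub>m h = f \<otimes>\<^sub>m (g \<otimes>\<^sub>m h)"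
  by (rule hom_tens_assoc) (auto simp: hom_iff)

lemma unit_tens [simp]: "arr f \<Longrightarrow> \<i> 0 \<otimes>\<^sub>m f = f"
  by (rule hom_unit_tens) (auto simp: hom_iff)

lemma tens_unit [simp]: "arr f \<Longrightarrow> f \<otimes>\<^sub>m \<i> 0 = f"
  by (rule hom_tens_unit) (auto simp: hom_iff)

lemmas tens_id [simp]

lemma id_tens_id_tens [simp]: "arr f \<Longrightarrow> \<i> m \<otimes>\<^sub>m (\<i> n \<otimes>\<^sub>m f) = \<i> (m + n) \<otimes>\<^sub>m f"
  by (simp flip: tens_assoc)

lemma interchange: "arr g \<Longrightarrow> arr f \<Longrightarrow> arr g' \<Longrightarrow> arr f' \<Longrightarrow> src g = tgt f \<Longrightarrow> src g' = tgt f' \<Longrightarrow>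
    (g \<cdot> f) \<otimes>\<^sub>m (g' \<cdot> f') = (g \<otimes>\<^sub>m g') \<cdot> (f \<otimes>\<^sub>m f')"
  by (rule hom_interchange) (auto simp: hom_iff)

lemma id_tens_comp [simp]: "arr g \<Longrightarrow> arr f \<Longrightarrow> src g = tgt f \<Longrightarrow>
    \<i> n \<otimes>\<^sub>m (g \<cdot> f) = (\<i> n \<otimes>\<^sub>m g) \<cdot> (\<i> n \<otimes>\<^sub>m f)"
  using interchange[of "\<i> n" "\<i> n" g f] by simp

lemma comp_tens_id [simp]: "arr g \<Longrightarrow> arr f \<Longrightarrow> src g = tgt f \<Longrightarrow>
    (g \<cdot> f) \<otimes>\<^sub>m \<i> n = (g \<otimes>\<^sub>m \<i> n) \<cdot> (f \<otimes>\<^sub>m \<i> n)"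
  using interchange[of g f "\<i> n" "\<i> n"] by simp

text \<open>Two diagrams on disjoint strands slide past each other.  This is the one law that the
  layered form leaves open, because it has no preferred direction; it is always applied by
  hand.\<close>

lemma exchange:
  assumes "arr f" "arr g"
  shows "(f \<otimes>\<^sub>m \<i> (tgt g)) \<cdot> (\<i> (src f) \<otimes>\<^sub>m g) = (\<i> (tgt f) \<otimes>\<^sub>m g) \<cdot> (f \<otimes>\<^sub>m \<i> (src g))"
  using assms interchange[of f "\<i> (src f)" "\<i> (tgt g)" g]
    interchange[of "\<i> (tgt f)" f g "\<i> (src g)"] by simp

lemma exchange_comp:
  assumes "arr f" "arr g" "arr h" "tgt h = src f + src g"
  shows "(f \<otimes>\<^sub>m \<i> (tgt g)) \<cdot> ((\<i> (src f) \<otimes>\<^sub>m g) \<cdot> h) = (\<i> (tgt f) \<otimes>\<^sub>m g) \<cdot> ((f \<otimes>\<^sub>m \<i> (src g)) \<cdot> h)"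
  using assms exchange[of f g] by (simp flip: comp_assoc)

lemma hom_smult_zero [simp]: "arr f \<Longrightarrow> src f = m \<Longrightarrow> tgt f = n \<Longrightarrow>
    0 \<odot>\<^bsub>Hom C m n\<^esub> f = \<zero>\<^bsub>Hom C m n\<^esub>"
  using hom.smult_l_null[of f m n] by (simp add: hom_iff)

lemma hom_smult_one [simp]: "arr f \<Longrightarrow> src f = m \<Longrightarrow> tgt f = n \<Longrightarrow>
    1 \<odot>\<^bsub>Hom C m n\<^esub> f = f"
  using hom.smult_one[of f m n] by (simp add: hom_iff)

lemma hom_smult_minus: "arr f \<Longrightarrow> src f = m \<Longrightarrow> tgt f = n \<Longrightarrow>
    (- c) \<odot>\<^bsub>Hom C m n\<^esub> f = \<ominus>\<^bsub>Hom C m n\<^esub> (c \<odot>\<^bsub>Hom C m n\<^esub> f)"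
  using hom.smult_l_minus[of c f m n] by (simp add: hom_iff class_ring_simps)

lemma hom_smult_smult [simp]: "arr f \<Longrightarrow> src f = m \<Longrightarrow> tgt f = n \<Longrightarrow>
    c \<odot>\<^bsub>Hom C m n\<^esub> (d \<odot>\<^bsub>Hom C m n\<^esub> f) = (c * d) \<odot>\<^bsub>Hom C m n\<^esub> f"
  using hom.smult_assoc1[of c d f m n] by (simp add: hom_iff)

lemma smult_arr [simp]:
  assumes "arr f" "src f = m" "tgt f = n"
  shows "arr (c \<odot>\<^bsub>Hom C m n\<^esub> f)" "src (c \<odot>\<^bsub>Hom C m n\<^esub> f) = m" "tgt (c \<odot>\<^bsub>Hom C m n\<^esub> f) = n"
  using hom.smult_closed[of c f m n] assms by (auto simp: hom_iff)

lemma comp_smult_left [simp]: "arr g \<Longrightarrow> arr f \<Longrightarrow> src g = m \<Longrightarrow> tgt g = n \<Longrightarrow> tgt f = m \<Longrightarrow>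
    (c \<odot>\<^bsub>Hom C m n\<^esub> g) \<cdot> f = c \<odot>\<^bsub>Hom C (src f) n\<^esub> (g \<cdot> f)"
  using LinearCombinations.module_hom_smult[OF comp_right_linear[of f "src f" m n]]
  by (simp add: hom_iff)

lemma comp_smult_right [simp]: "arr g \<Longrightarrow> arr f \<Longrightarrow> src g = m \<Longrightarrow> tgt f = m \<Longrightarrow> src f = l \<Longrightarrow>
    g \<cdot> (c \<odot>\<^bsub>Hom C l m\<^esub> f) = c \<odot>\<^bsub>Hom C l (tgt g)\<^esub> (g \<cdot> f)"
  using LinearCombinations.module_hom_smult[OF comp_left_linear[of g m "tgt g" l]]
  by (simp add: hom_iff)

lemma tens_smult_left [simp]: "arr f \<Longrightarrow> arr g \<Longrightarrow> src f = m \<Longrightarrow> tgt f = n \<Longrightarrow>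
    (c \<odot>\<^bsub>Hom C m n\<^esub> f) \<otimes>\<^sub>m g = c \<odot>\<^bsub>Hom C (m + src g) (n + tgt g)\<^esub> (f \<otimes>\<^sub>m g)"
  using LinearCombinations.module_hom_smult[OF tens_right_linear[of g "src g" "tgt g" m n]]
  by (simp add: hom_iff)

lemma tens_smult_right [simp]: "arr f \<Longrightarrow> arr g \<Longrightarrow> src g = m \<Longrightarrow> tgt g = n \<Longrightarrow>
    f \<otimes>\<^sub>m (c \<odot>\<^bsub>Hom C m n\<^esub> g) = c \<odot>\<^bsub>Hom C (src f + m) (tgt f + n)\<^esub> (f \<otimes>\<^sub>m g)"
  using LinearCombinations.module_hom_smult[OF tens_left_linear[of f "src f" "tgt f" m n]]
  by (simp add: hom_iff)

lemma zero_arr [simp]: "arr \<zero>\<^bsub>Hom C m n\<^esub>" "src \<zero>\<^bsub>Hom C m n\<^esub> = m" "tgt \<zero>\<^bsub>Hom C m n\<^esub> = n"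
  using hom.zero_closed[of m n] by (auto simp: hom_iff)

lemma minus_arr [simp]:
  assumes "arr f" "src f = m" "tgt f = n"
  shows "arr (\<ominus>\<^bsub>Hom C m n\<^esub> f)" "src (\<ominus>\<^bsub>Hom C m n\<^esub> f) = m" "tgt (\<ominus>\<^bsub>Hom C m n\<^esub> f) = n"
  using hom.a_inv_closed[of f m n] assms by (auto simp: hom_iff)

lemma add_arr [simp]:
  assumes "arr f" "arr g" "src f = m" "src g = m" "tgt f = n" "tgt g = n"
  shows "arr (f \<oplus>\<^bsub>Hom C m n\<^esub> g)" "src (f \<oplus>\<^bsub>Hom C m n\<^esub> g) = m" "tgt (f \<oplus>\<^bsub>Hom C m n\<^esub> g) = n"
  using hom.a_closed[of f m n g] assms by (auto simp: hom_iff)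

lemma comp_add_left [simp]: "arr g \<Longrightarrow> arr g' \<Longrightarrow> arr f \<Longrightarrow> src g = m \<Longrightarrow> src g' = m \<Longrightarrow>
    tgt g = n \<Longrightarrow> tgt g' = n \<Longrightarrow> tgt f = m \<Longrightarrow>
    (g \<oplus>\<^bsub>Hom C m n\<^esub> g') \<cdot> f = g \<cdot> f \<oplus>\<^bsub>Hom C (src f) n\<^esub> g' \<cdot> f"
  using LinearCombinations.module_hom_add[OF comp_right_linear[of f "src f" m n]]
  by (simp add: hom_iff)

lemma comp_add_right [simp]: "arr g \<Longrightarrow> arr f \<Longrightarrow> arr f' \<Longrightarrow> src g = m \<Longrightarrow> tgt f = m \<Longrightarrow>
    tgt f' = m \<Longrightarrow> src f = l \<Longrightarrow> src f' = l \<Longrightarrow>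
    g \<cdot> (f \<oplus>\<^bsub>Hom C l m\<^esub> f') = g \<cdot> f \<oplus>\<^bsub>Hom C l (tgt g)\<^esub> g \<cdot> f'"
  using LinearCombinations.module_hom_add[OF comp_left_linear[of g m "tgt g" l]]
  by (simp add: hom_iff)

lemma tens_add_left [simp]: "arr f \<Longrightarrow> arr f' \<Longrightarrow> arr g \<Longrightarrow> src f = m \<Longrightarrow> src f' = m \<Longrightarrow>
    tgt f = n \<Longrightarrow> tgt f' = n \<Longrightarrow>
    (f \<oplus>\<^bsub>Hom C m n\<^esub> f') \<otimes>\<^sub>m g = f \<otimes>\<^sub>m g \<oplus>\<^bsub>Hom C (m + src g) (n + tgt g)\<^esub> f' \<otimes>\<^sub>m g"
  using LinearCombinations.module_hom_add[OF tens_right_linear[of g "src g" "tgt g" m n]]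
  by (simp add: hom_iff)

lemma comp_zero_right [simp]: "arr g \<Longrightarrow> src g = m \<Longrightarrow>
    g \<cdot> \<zero>\<^bsub>Hom C l m\<^esub> = \<zero>\<^bsub>Hom C l (tgt g)\<^esub>"
  using comp_smult_right[of g "\<zero>\<^bsub>Hom C l m\<^esub>" m l 0] by simp

lemma comp_zero_left [simp]: "arr f \<Longrightarrow> tgt f = m \<Longrightarrow>
    \<zero>\<^bsub>Hom C m n\<^esub> \<cdot> f = \<zero>\<^bsub>Hom C (src f) n\<^esub>"
  using comp_smult_left[of "\<zero>\<^bsub>Hom C m n\<^esub>" f m n 0] by simp

lemma tens_zero_right [simp]: "arr f \<Longrightarrow>
    f \<otimes>\<^sub>m \<zero>\<^bsub>Hom C m n\<^esub> = \<zero>\<^bsub>Hom C (src f + m) (tgt f + n)\<^esub>"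
  using tens_smult_right[of f "\<zero>\<^bsub>Hom C m n\<^esub>" m n 0] by simp

lemma smult_eq_zero_iff:
  assumes "arr f" "src f = m" "tgt f = n"
  shows "c \<odot>\<^bsub>Hom C m n\<^esub> f = \<zero>\<^bsub>Hom C m n\<^esub> \<longleftrightarrow> c = 0 \<or> f = \<zero>\<^bsub>Hom C m n\<^esub>"
proof -
  have "f = \<zero>\<^bsub>Hom C m n\<^esub>" if "c \<odot>\<^bsub>Hom C m n\<^esub> f = \<zero>\<^bsub>Hom C m n\<^esub>" "c \<noteq> 0"
  proof -
    have "f = inverse c \<odot>\<^bsub>Hom C m n\<^esub> (c \<odot>\<^bsub>Hom C m n\<^esub> f)" using that(2) assms by simp
    then show ?thesis using that(1) hom.smult_r_null[of "inverse c" m n] by simp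
  qed
  then show ?thesis using assms hom_smult_zero[of f m n] hom.smult_r_null[of c m n] by fastforce
qed

lemma eq_smult_minus_one_zero:
  assumes "(2::'k) \<noteq> 0" "arr f" "src f = m" "tgt f = n" "f = - 1 \<odot>\<^bsub>Hom C m n\<^esub> f"
  shows "f = \<zero>\<^bsub>Hom C m n\<^esub>"
proof -
  have "(1 + 1) \<odot>\<^bsub>Hom C m n\<^esub> f = f \<oplus>\<^bsub>Hom C m n\<^esub> (- 1 \<odot>\<^bsub>Hom C m n\<^esub> f)"
    using hom.smult_l_distr[of 1 1 f m n] assms by (simp add: hom_iff)
  also have "\<dots> = (1 + - 1) \<odot>\<^bsub>Hom C m n\<^esub> f"
    using hom.smult_l_distr[of 1 "- 1" f m n] assms(2-4) by (simp add: hom_iff)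
  also have "\<dots> = \<zero>\<^bsub>Hom C m n\<^esub>" using assms by simp
  finally show ?thesis using assms by (simp add: smult_eq_zero_iff)
qed

lemma tens_zero_left [simp]: "arr g \<Longrightarrow>
    \<zero>\<^bsub>Hom C m n\<^esub> \<otimes>\<^sub>m g = \<zero>\<^bsub>Hom C (m + src g) (n + tgt g)\<^esub>"
  using tens_smult_left[of "\<zero>\<^bsub>Hom C m n\<^esub>" g m n 0] by simp

lemma sub_arr [simp]:
  assumes "arr f" "arr g" "src f = m" "src g = m" "tgt f = n" "tgt g = n"
  shows "arr (f \<ominus>\<^bsub>Hom C m n\<^esub> g)" "src (f \<ominus>\<^bsub>Hom C m n\<^esub> g) = m" "tgt (f \<ominus>\<^bsub>Hom C m n\<^esub> g) = n"
  using assms by (simp_all add: hom.minus_eq)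

lemma hom_vectorspace: "vectorspace class_ring (Hom C m n)"
  by (rule vectorspace.intro[OF hom_module class_field])

text \<open>If the identity of the generating object vanishes then so does that of \<open>2\<close>, and with it
  every endomorphism of \<open>2\<close>.\<close>

lemma dim_hom_zero:
  assumes "\<i> 1 = \<zero>\<^bsub>Hom C 1 1\<^esub>" "vectorspace.fin_dim class_ring (Hom C 2 2)"
  shows "vectorspace.dim class_ring (Hom C 2 2) = 0"
proof -
  interpret V: vectorspace class_ring "Hom C 2 2" by (rule hom_vectorspace)
  have "\<i> 2 = \<i> 1 \<otimes>\<^sub>m \<i> 1" by (simp del: One_nat_def)
  also have "\<dots> = \<zero>\<^bsub>Hom C 2 2\<^esub>" by (subst assms(1)) (simp del: One_nat_def)
  finally have zero: "f = \<zero>\<^bsub>Hom C 2 2\<^esub>" if "f \<in> carrier (Hom C 2 2)" for f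
    using that id_comp[of f 2] comp_zero_left[of f 2 2] by (simp add: hom_iff)
  obtain B where B: "finite B" "V.basis B" using V.finite_basis_exists[OF assms(2)] by blast
  then have "B = {}"
    using V.vs_zero_lin_dep[of B] zero by (auto simp: V.basis_def)
  then show ?thesis using V.dim_basis[OF B] by simp
qed

end

section \<open>Diagrams with three inputs and one output\<close>

text \<open>A self-dual object with a symmetric duality, a swap of two strands, and an antisymmetric
  multiplication that is compatible with both.  The scalar \<open>\<delta>\<close> is the value of a circle, and \<open>\<alpha>\<close>
  that of splitting a strand and multiplying the two halves.\<close>

locale trivalent = linear_pro C for C :: "(nat, 'm, 'k::field) monoidal_cat" (structure) +
  fixes \<mu> s \<eta> \<epsilon> :: 'm and \<delta> \<alpha> :: 'k
  assumes mult_hom: "\<mu> \<in> carrier (Hom C 2 1)" and swap_hom: "s \<in> carrier (Hom C 2 2)"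
    and cup_hom: "\<eta> \<in> carrier (Hom C 0 2)" and cap_hom: "\<epsilon> \<in> carrier (Hom C 2 0)"
    and snake1: "(\<epsilon> \<otimes>\<^sub>m \<i> 1) \<cdot> (\<i> 1 \<otimes>\<^sub>m \<eta>) = \<i> 1"
    and snake2: "(\<i> 1 \<otimes>\<^sub>m \<epsilon>) \<cdot> (\<eta> \<otimes>\<^sub>m \<i> 1) = \<i> 1"
    and split: "(\<i> 1 \<otimes>\<^sub>m \<mu>) \<cdot> (\<eta> \<otimes>\<^sub>m \<i> 1) = (\<mu> \<otimes>\<^sub>m \<i> 1) \<cdot> (\<i> 1 \<otimes>\<^sub>m \<eta>)"
    and slide_cap: "(\<i> 1 \<otimes>\<^sub>m \<epsilon>) \<cdot> (s \<otimes>\<^sub>m \<i> 1) = (\<epsilon> \<otimes>\<^sub>m \<i> 1) \<cdot> (\<i> 1 \<otimes>\<^sub>m s)"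
    and swap_swap: "s \<cdot> s = \<i> 2"
    and slide_mult: "(\<i> 1 \<otimes>\<^sub>m \<mu>) \<cdot> (s \<otimes>\<^sub>m \<i> 1) \<cdot> (\<i> 1 \<otimes>\<^sub>m s) = s \<cdot> (\<mu> \<otimes>\<^sub>m \<i> 1)"
    and cap_swap: "\<epsilon> \<cdot> s = \<epsilon>"
    and mult_swap: "\<mu> \<cdot> s = - 1 \<odot>\<^bsub>Hom C 2 1\<^esub> \<mu>"
    and mult_split: "\<mu> \<cdot> ((\<mu> \<otimes>\<^sub>m \<i> 1) \<cdot> (\<i> 1 \<otimes>\<^sub>m \<eta>)) = \<alpha> \<odot>\<^bsub>Hom C 1 1\<^esub> \<i> 1"
    and cap_cup: "\<epsilon> \<cdot> \<eta> = \<delta> \<odot>\<^bsub>Hom C 0 0\<^esub> \<i> 0"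
begin

text \<open>Rewritten to \<open>Suc 0\<close>, the width \<open>1\<close> would no longer add up with numerals.\<close>

declare One_nat_def [simp del]

lemma gen_arr [simp]:
  "arr \<mu>" "src \<mu> = 2" "tgt \<mu> = 1" "arr s" "src s = 2" "tgt s = 2"
  "arr \<eta>" "src \<eta> = 0" "tgt \<eta> = 2" "arr \<epsilon>" "src \<epsilon> = 2" "tgt \<epsilon> = 0"
  using mult_hom swap_hom cup_hom cap_hom by (simp_all add: hom_iff)

text \<open>A curl can be undone.  Under one more cap, \<open>slide_cap\<close> moves the crossing of the curl
  onto the two free inputs; the cup then straightens out, and the crossing is absorbed by the
  remaining cap.  Since capping is injective by duality, the curl is the identity.\<close>

lemma cap_twist: "(\<i> 1 \<otimes>\<^sub>m \<epsilon>) \<cdot> ((s \<otimes>\<^sub>m \<i> 1) \<cdot> (\<i> 1 \<otimes>\<^sub>m \<eta>)) = \<i> 1" (is "?\<theta> = _")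
proof -
  have "\<epsilon> \<cdot> (\<i> 1 \<otimes>\<^sub>m ?\<theta>) = \<epsilon> \<cdot> ((\<i> 2 \<otimes>\<^sub>m \<epsilon>) \<cdot> ((\<i> 1 \<otimes>\<^sub>m (s \<otimes>\<^sub>m \<i> 1)) \<cdot> (\<i> 2 \<otimes>\<^sub>m \<eta>)))"
    by simp
  also have "\<dots> = \<epsilon> \<cdot> ((((\<epsilon> \<otimes>\<^sub>m \<i> 1) \<cdot> (\<i> 1 \<otimes>\<^sub>m s)) \<otimes>\<^sub>m \<i> 1) \<cdot> (\<i> 2 \<otimes>\<^sub>m \<eta>))"
    using exchange_comp[of \<epsilon> \<epsilon> "(\<i> 1 \<otimes>\<^sub>m (s \<otimes>\<^sub>m \<i> 1)) \<cdot> (\<i> 2 \<otimes>\<^sub>m \<eta>)"] by simp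
  also have "\<dots> = \<epsilon> \<cdot> ((\<i> 1 \<otimes>\<^sub>m (\<epsilon> \<otimes>\<^sub>m \<i> 1)) \<cdot> ((s \<otimes>\<^sub>m \<i> 2) \<cdot> (\<i> 2 \<otimes>\<^sub>m \<eta>)))"
    by (simp flip: slide_cap)
  also have "(s \<otimes>\<^sub>m \<i> 2) \<cdot> (\<i> 2 \<otimes>\<^sub>m \<eta>) = (\<i> 2 \<otimes>\<^sub>m \<eta>) \<cdot> s"
    using exchange[of s \<eta>] by simp
  also have "\<epsilon> \<cdot> ((\<i> 1 \<otimes>\<^sub>m (\<epsilon> \<otimes>\<^sub>m \<i> 1)) \<cdot> ((\<i> 2 \<otimes>\<^sub>m \<eta>) \<cdot> s))
      = \<epsilon> \<cdot> ((\<i> 1 \<otimes>\<^sub>m ((\<epsilon> \<otimes>\<^sub>m \<i> 1) \<cdot> (\<i> 1 \<otimes>\<^sub>m \<eta>))) \<cdot> s)"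
    by simp
  also have "\<dots> = \<epsilon>" by (simp only: snake1) (simp add: cap_swap)
  finally have *: "\<epsilon> \<cdot> (\<i> 1 \<otimes>\<^sub>m ?\<theta>) = \<epsilon>" .
  \<comment> \<open>Bending the capped strand back recovers the curl.\<close>
  have "?\<theta> = ((\<i> 1 \<otimes>\<^sub>m \<epsilon>) \<cdot> (\<eta> \<otimes>\<^sub>m \<i> 1)) \<cdot> ?\<theta>" by (simp only: snake2) simp
  also have "\<dots> = (\<i> 1 \<otimes>\<^sub>m (\<epsilon> \<cdot> (\<i> 1 \<otimes>\<^sub>m ?\<theta>))) \<cdot> (\<eta> \<otimes>\<^sub>m \<i> 1)"
    using exchange[of \<eta> ?\<theta>] by simp
  also have "\<dots> = \<i> 1" by (simp only: * snake2)
  finally show ?thesis .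
qed

text \<open>The mirror image of \<open>cap_swap\<close>: straightening one strand of the crossed cup produces a
  curl.\<close>

lemma swap_cup: "s \<cdot> \<eta> = \<eta>"
proof -
  have "s \<cdot> \<eta> = (((\<i> 1 \<otimes>\<^sub>m \<epsilon>) \<cdot> (\<eta> \<otimes>\<^sub>m \<i> 1)) \<otimes>\<^sub>m \<i> 1) \<cdot> (s \<cdot> \<eta>)"
    by (simp only: snake2) simp
  also have "\<dots> = (\<i> 1 \<otimes>\<^sub>m (((\<epsilon> \<otimes>\<^sub>m \<i> 1) \<cdot> (\<i> 1 \<otimes>\<^sub>m s)) \<cdot> (\<i> 1 \<otimes>\<^sub>m \<eta>))) \<cdot> \<eta>"
    using exchange[of \<eta> "s \<cdot> \<eta>"] by simp
  also have "((\<epsilon> \<otimes>\<^sub>m \<i> 1) \<cdot> (\<i> 1 \<otimes>\<^sub>m s)) \<cdot> (\<i> 1 \<otimes>\<^sub>m \<eta>) = \<i> 1"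
    unfolding slide_cap[symmetric] using cap_twist by simp
  finally show ?thesis by simp
qed

text \<open>The digits name the two inputs that meet first.  Their product is the left factor of the
  outer multiplication, except in \<open>tree23\<close>, where it is the right factor; hence the signs in
  the Jacobi identity \<open>tree12 - tree23 - tree13 = 0\<close>.\<close>

definition chord12 :: 'm where "chord12 = \<epsilon> \<otimes>\<^sub>m \<i> 1"
definition chord23 :: 'm where "chord23 = \<i> 1 \<otimes>\<^sub>m \<epsilon>"
definition chord13 :: 'm where "chord13 = (\<i> 1 \<otimes>\<^sub>m \<epsilon>) \<cdot> (s \<otimes>\<^sub>m \<i> 1)"
definition tree12 :: 'm where "tree12 = \<mu> \<cdot> (\<mu> \<otimes>\<^sub>m \<i> 1)"
definition tree23 :: 'm where "tree23 = \<mu> \<cdot> (\<i> 1 \<otimes>\<^sub>m \<mu>)"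
definition tree13 :: 'm where "tree13 = \<mu> \<cdot> (\<mu> \<otimes>\<^sub>m \<i> 1) \<cdot> (\<i> 1 \<otimes>\<^sub>m s)"

lemmas diagram_defs = chord12_def chord23_def chord13_def tree12_def tree23_def tree13_def

lemma diagram_arr [simp]:
  "arr chord12" "src chord12 = 3" "tgt chord12 = 1"
  "arr chord23" "src chord23 = 3" "tgt chord23 = 1"
  "arr chord13" "src chord13 = 3" "tgt chord13 = 1" "arr tree12" "src tree12 = 3" "tgt tree12 = 1"
  "arr tree23" "src tree23 = 3" "tgt tree23 = 1" "arr tree13" "src tree13 = 3" "tgt tree13 = 1"
  by (simp_all add: diagram_defs)

lemma swaps_cancel:
  "(s \<otimes>\<^sub>m \<i> 1) \<cdot> (s \<otimes>\<^sub>m \<i> 1) = \<i> 3" "(\<i> 1 \<otimes>\<^sub>m s) \<cdot> (\<i> 1 \<otimes>\<^sub>m s) = \<i> 3"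
  using comp_tens_id[of s s 1, symmetric] id_tens_comp[of s s 1, symmetric]
  by (simp_all add: swap_swap)

lemma chord_swap12:
  "chord12 \<cdot> (s \<otimes>\<^sub>m \<i> 1) = chord12" "chord23 \<cdot> (s \<otimes>\<^sub>m \<i> 1) = chord13"
  "chord13 \<cdot> (s \<otimes>\<^sub>m \<i> 1) = chord23"
  using comp_tens_id[of \<epsilon> s 1, symmetric] by (simp_all add: diagram_defs cap_swap swaps_cancel)

lemma chord_swap23:
  "chord12 \<cdot> (\<i> 1 \<otimes>\<^sub>m s) = chord13" "chord23 \<cdot> (\<i> 1 \<otimes>\<^sub>m s) = chord23"
  "chord13 \<cdot> (\<i> 1 \<otimes>\<^sub>m s) = chord12"
  using id_tens_comp[of \<epsilon> s 1, symmetric]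
  by (simp_all add: diagram_defs cap_swap slide_cap swaps_cancel)

lemma tree_swap23:
  "tree12 \<cdot> (\<i> 1 \<otimes>\<^sub>m s) = tree13" "tree13 \<cdot> (\<i> 1 \<otimes>\<^sub>m s) = tree12"
  "tree23 \<cdot> (\<i> 1 \<otimes>\<^sub>m s) = - 1 \<odot>\<^bsub>Hom C 3 1\<^esub> tree23"
  using id_tens_comp[of \<mu> s 1, symmetric]
  by (simp_all add: diagram_defs mult_swap swaps_cancel)

text \<open>Only \<open>tree23\<close> needs an argument: \<open>slide_mult\<close> pulls the product of two strands through the
  third, and antisymmetry of the outer multiplication removes the resulting crossing.  The
  rule for \<open>tree13\<close> follows since the swap is an involution.\<close>

lemma tree_swap12:
  "tree12 \<cdot> (s \<otimes>\<^sub>m \<i> 1) = - 1 \<odot>\<^bsub>Hom C 3 1\<^esub> tree12"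
  "tree23 \<cdot> (s \<otimes>\<^sub>m \<i> 1) = - 1 \<odot>\<^bsub>Hom C 3 1\<^esub> tree13"
  "tree13 \<cdot> (s \<otimes>\<^sub>m \<i> 1) = - 1 \<odot>\<^bsub>Hom C 3 1\<^esub> tree23"
proof -
  show "tree12 \<cdot> (s \<otimes>\<^sub>m \<i> 1) = - 1 \<odot>\<^bsub>Hom C 3 1\<^esub> tree12"
    using comp_tens_id[of \<mu> s 1, symmetric] by (simp add: diagram_defs mult_swap)
  have "tree23 \<cdot> ((s \<otimes>\<^sub>m \<i> 1) \<cdot> (\<i> 1 \<otimes>\<^sub>m s)) = (\<mu> \<cdot> s) \<cdot> (\<mu> \<otimes>\<^sub>m \<i> 1)"
    using slide_mult by (simp add: tree23_def)
  also have "\<dots> = - 1 \<odot>\<^bsub>Hom C 3 1\<^esub> tree12"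
    by (simp only: mult_swap) (simp add: tree12_def)
  finally have "(tree23 \<cdot> ((s \<otimes>\<^sub>m \<i> 1) \<cdot> (\<i> 1 \<otimes>\<^sub>m s))) \<cdot> (\<i> 1 \<otimes>\<^sub>m s)
      = (- 1 \<odot>\<^bsub>Hom C 3 1\<^esub> tree12) \<cdot> (\<i> 1 \<otimes>\<^sub>m s)" by simp
  then show 23: "tree23 \<cdot> (s \<otimes>\<^sub>m \<i> 1) = - 1 \<odot>\<^bsub>Hom C 3 1\<^esub> tree13"
    by (simp add: swaps_cancel tree_swap23)
  have "tree13 = - 1 \<odot>\<^bsub>Hom C 3 1\<^esub> (tree23 \<cdot> (s \<otimes>\<^sub>m \<i> 1))" by (simp add: 23)
  then have "tree13 \<cdot> (s \<otimes>\<^sub>m \<i> 1) = (- 1 \<odot>\<^bsub>Hom C 3 1\<^esub> (tree23 \<cdot> (s \<otimes>\<^sub>m \<i> 1))) \<cdot> (s \<otimes>\<^sub>m \<i> 1)"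
    by simp
  then show "tree13 \<cdot> (s \<otimes>\<^sub>m \<i> 1) = - 1 \<odot>\<^bsub>Hom C 3 1\<^esub> tree23"
    by (simp add: swaps_cancel del: 23)
qed

lemma chord_closing:
  "chord12 \<cdot> (\<i> 1 \<otimes>\<^sub>m \<eta>) = \<i> 1" "chord23 \<cdot> (\<i> 1 \<otimes>\<^sub>m \<eta>) = \<delta> \<odot>\<^bsub>Hom C 1 1\<^esub> \<i> 1"
  "chord13 \<cdot> (\<i> 1 \<otimes>\<^sub>m \<eta>) = \<i> 1"
  using id_tens_comp[of \<epsilon> \<eta> 1, symmetric] cap_twist by (simp_all add: diagram_defs snake1 cap_cup)

text \<open>The cup is symmetric and the multiplication antisymmetric.\<close>

lemma mult_cup: "(2::'k) \<noteq> 0 \<Longrightarrow> \<mu> \<cdot> \<eta> = \<zero>\<^bsub>Hom C 0 1\<^esub>"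
proof (rule eq_smult_minus_one_zero)
  have "\<mu> \<cdot> \<eta> = (\<mu> \<cdot> s) \<cdot> \<eta>" by (simp add: swap_cup)
  then show "\<mu> \<cdot> \<eta> = - 1 \<odot>\<^bsub>Hom C 0 1\<^esub> (\<mu> \<cdot> \<eta>)" by (simp add: mult_swap)
qed simp_all

lemma tree_closing:
  assumes "(2::'k) \<noteq> 0"
  shows "tree12 \<cdot> (\<i> 1 \<otimes>\<^sub>m \<eta>) = \<alpha> \<odot>\<^bsub>Hom C 1 1\<^esub> \<i> 1"
    "tree23 \<cdot> (\<i> 1 \<otimes>\<^sub>m \<eta>) = \<zero>\<^bsub>Hom C 1 1\<^esub>"
    "tree13 \<cdot> (\<i> 1 \<otimes>\<^sub>m \<eta>) = \<alpha> \<odot>\<^bsub>Hom C 1 1\<^esub> \<i> 1"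
proof -
  show 1: "tree12 \<cdot> (\<i> 1 \<otimes>\<^sub>m \<eta>) = \<alpha> \<odot>\<^bsub>Hom C 1 1\<^esub> \<i> 1"
    using mult_split by (simp add: tree12_def)
  show "tree23 \<cdot> (\<i> 1 \<otimes>\<^sub>m \<eta>) = \<zero>\<^bsub>Hom C 1 1\<^esub>"
    using id_tens_comp[of \<mu> \<eta> 1, symmetric] mult_cup[OF assms] by (simp add: tree23_def)
  have "(\<i> 1 \<otimes>\<^sub>m s) \<cdot> (\<i> 1 \<otimes>\<^sub>m \<eta>) = \<i> 1 \<otimes>\<^sub>m \<eta>"
    using id_tens_comp[of s \<eta> 1, symmetric] by (simp add: swap_cup)
  then show "tree13 \<cdot> (\<i> 1 \<otimes>\<^sub>m \<eta>) = \<alpha> \<odot>\<^bsub>Hom C 1 1\<^esub> \<i> 1"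
    using 1 by (simp add: tree13_def tree12_def)
qed

text \<open>The third input is turned round to become a second output.\<close>

definition bend :: "'m \<Rightarrow> 'm" where "bend g = (g \<otimes>\<^sub>m \<i> 1) \<cdot> (\<i> 2 \<otimes>\<^sub>m \<eta>)"

lemma bend_arr [simp]: "arr g \<Longrightarrow> src g = 3 \<Longrightarrow> tgt g = 1 \<Longrightarrow> arr (bend g)"
  "arr g \<Longrightarrow> src g = 3 \<Longrightarrow> tgt g = 1 \<Longrightarrow> src (bend g) = 2"
  "arr g \<Longrightarrow> src g = 3 \<Longrightarrow> tgt g = 1 \<Longrightarrow> tgt (bend g) = 2"
  by (simp_all add: bend_def)

lemma unbend_bend:
  assumes "arr g" "src g = 3" "tgt g = 1"
  shows "(\<i> 1 \<otimes>\<^sub>m \<epsilon>) \<cdot> (bend g \<otimes>\<^sub>m \<i> 1) = g"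
proof -
  have "(\<i> 1 \<otimes>\<^sub>m \<epsilon>) \<cdot> (bend g \<otimes>\<^sub>m \<i> 1)
      = g \<cdot> (\<i> 2 \<otimes>\<^sub>m ((\<i> 1 \<otimes>\<^sub>m \<epsilon>) \<cdot> (\<eta> \<otimes>\<^sub>m \<i> 1)))"
    using assms exchange_comp[of g \<epsilon> "\<i> 2 \<otimes>\<^sub>m (\<eta> \<otimes>\<^sub>m \<i> 1)"] by (simp add: bend_def)
  also have "\<dots> = g" by (simp only: snake2) (simp add: assms)
  finally show ?thesis .
qed

lemma bend_chord: "bend chord23 = \<i> 2" "bend chord13 = s"
proof -
  show 1: "bend chord23 = \<i> 2"
    using id_tens_comp[of "\<epsilon> \<otimes>\<^sub>m \<i> 1" "\<i> 1 \<otimes>\<^sub>m \<eta>" 1, symmetric]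
    by (simp add: bend_def chord23_def snake1)
  have "bend chord13 = bend chord23 \<cdot> s"
    using exchange[of s \<eta>] by (simp add: bend_def chord13_def chord23_def)
  then show "bend chord13 = s" by (simp add: 1)
qed

end

section \<open>Linear relations among the six diagrams\<close>

text \<open>The six coordinates are the coefficients of \<open>chord12\<close>, \<open>chord23\<close>, \<open>chord13\<close>, \<open>tree12\<close>,
  \<open>tree23\<close> and \<open>tree13\<close>, in this order.  The assumptions \<open>swap12\<close> and \<open>swap23\<close> describe the action
  of the two generating transpositions, \<open>closing\<close> is the effect of joining the second and third
  input by a cup, and \<open>sep\<close> says that \<open>chord23\<close> and \<open>chord13\<close> differ.  The conclusion offers the
  Jacobi identity and the vector product identity for the rescaled cap.

  Antisymmetrising a relation under the first transposition leaves one of the form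
  \<open>(0, p, - p, q, w, w)\<close>.  Its three rotations add up to \<open>q - 2 * w\<close> times the Jacobi
  identity; if this factor vanishes, closing links \<open>p\<close> and \<open>w\<close>.  If the antisymmetrisations of all
  rotations vanish, the relation is a multiple of the sum of the chords, which closing
  excludes.\<close>

lemma relation_space_dichotomy:
  fixes N :: "'k::field \<Rightarrow> 'k \<Rightarrow> 'k \<Rightarrow> 'k \<Rightarrow> 'k \<Rightarrow> 'k \<Rightarrow> bool"
  assumes add: "\<And>a b c d e f a' b' c' d' e' f'. N a b c d e f \<Longrightarrow> N a' b' c' d' e' f' \<Longrightarrow>
      N (a + a') (b + b') (c + c') (d + d') (e + e') (f + f')"
    and scale: "\<And>x a b c d e f. N a b c d e f \<Longrightarrow> N (x * a) (x * b) (x * c) (x * d) (x * e) (x * f)"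
    and swap12: "\<And>a b c d e f. N a b c d e f \<Longrightarrow> N a c b (- d) (- f) (- e)"
    and swap23: "\<And>a b c d e f. N a b c d e f \<Longrightarrow> N c b a f (- e) d"
    and closing: "\<And>a b c d e f. N a b c d e f \<Longrightarrow> a + \<delta> * b + c + \<alpha> * (d + f) = 0"
    and sep: "\<not> N 0 1 (- 1) 0 0 0"
    and field: "(2::'k) \<noteq> 0" "\<delta> \<noteq> - 2" "\<alpha> \<noteq> 0"
    and N: "N a b c d e f" and nonzero: "(a, b, c, d, e, f) \<noteq> (0, 0, 0, 0, 0, 0)"
  shows "N 0 0 0 1 (- 1) (- 1) \<or> (\<exists>\<kappa>. \<kappa> \<noteq> 0 \<and> N \<kappa> \<kappa> (- 2 * \<kappa>) 1 1 0)" (is ?thesis)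
proof -
  have diff: "N (a - a') (b - b') (c - c') (d - d') (e - e') (f - f')"
    if "N a b c d e f" "N a' b' c' d' e' f'" for a b c d e f a' b' c' d' e' f'
    using add[OF that(1) scale[OF that(2), of "- 1"]] by simp
  have rot: "N c a b (- f) (- d) e" if "N a b c d e f" for a b c d e f
    using swap12[OF swap23[OF that]] by simp
  have key: ?thesis if v: "N 0 p (- p) q w w" and "p \<noteq> 0 \<or> q \<noteq> 0 \<or> w \<noteq> 0" for p q w
  proof (cases "q = 2 * w")
    case False
    define r where "r = q - 2 * w"
    have "N 0 0 0 r (- r) (- r)" unfolding r_def
      using add[OF v add[OF rot[OF v] rot[OF rot[OF v]]]] by (simp add: algebra_simps)
    moreover have "r \<noteq> 0" using False by (simp add: r_def)
    ultimately show ?thesis using scale[of 0 0 0 r "- r" "- r" "inverse r"] by simp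
  next
    case True
    have cl: "p * (\<delta> - 1) = - 3 * (\<alpha> * w)"
      using closing[OF v] True by (simp add: algebra_simps eq_neg_iff_add_eq_0)
    show ?thesis
    proof (cases "w = 0")
      case True
      then have "p \<noteq> 0" "q = 0" using that(2) \<open>q = 2 * w\<close> by auto
      then show ?thesis using scale[OF v, of "inverse p"] sep True by simp
    next
      case w: False
      show ?thesis
      proof (cases "(3::'k) = 0")
        \<comment> \<open>Closing gives \<open>p * (\<delta> + 2) = 0\<close>, and only trees survive.\<close>
        case three: True
        then have "\<delta> - 1 = \<delta> + 2" by (simp add: algebra_simps)
        then have "p = 0" using cl three field by (auto simp: eq_neg_iff_add_eq_0)
        moreover have "q + w = 3 * w" using True by simp
        then have "q = - w" using three by (simp add: eq_neg_iff_add_eq_0)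
        ultimately have "N 0 0 0 (- w) w w" using v by simp
        from scale[OF this, of "- inverse w"] show ?thesis using w by simp
      next
        \<comment> \<open>In the difference of two rotations only two trees remain, with coefficient \<open>3 * w\<close>.\<close>
        case three: False
        then have "p \<noteq> 0" using cl w field by auto
        moreover have "N (p / (3 * w)) (p / (3 * w)) (- 2 * (p / (3 * w))) 1 1 0"
          using scale[OF diff[OF v rot[OF v]], of "inverse (3 * w)"] True w three
          by (simp add: field_simps)
        ultimately show ?thesis using w three by (intro disjI2 exI[of _ "p / (3 * w)"]) simp
      qed
    qed
  qed
  have antisym: "N 0 (b - c) (- (b - c)) (2 * d) (e + f) (e + f)" if "N a b c d e f" for a b c d e f
    using diff[OF that swap12[OF that]] by (simp add: algebra_simps)
  show ?thesis
  proof (rule ccontr)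
    assume not: "\<not> ?thesis"
    have 1: "b = c" "d = 0" using key[OF antisym[OF N]] not field by auto
    have 2: "a = b" "f = 0" using key[OF antisym[OF rot[OF N]]] not field by auto
    have 3: "e = 0" using key[OF antisym[OF rot[OF rot[OF N]]]] not field by auto
    have "b * (\<delta> + 2) = 0" using closing[OF N] 1 2 by (simp add: algebra_simps)
    then have "b = 0" using field by (simp add: eq_neg_iff_add_eq_0)
    then show False using 1 2 3 nonzero by simp
  qed
qed

context trivalent
begin

text \<open>Right-nested sums let \<open>smult_sum_pairs\<close> add two combinations coefficient by coefficient.\<close>

definition comb :: "'k \<Rightarrow> 'k \<Rightarrow> 'k \<Rightarrow> 'k \<Rightarrow> 'k \<Rightarrow> 'k \<Rightarrow> 'm" where
  "comb a b c d e f = a \<odot>\<^bsub>Hom C 3 1\<^esub> chord12 \<oplus>\<^bsub>Hom C 3 1\<^esub> (b \<odot>\<^bsub>Hom C 3 1\<^esub> chord23 \<oplus>\<^bsub>Hom C 3 1\<^esub>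
    (c \<odot>\<^bsub>Hom C 3 1\<^esub> chord13 \<oplus>\<^bsub>Hom C 3 1\<^esub> (d \<odot>\<^bsub>Hom C 3 1\<^esub> tree12 \<oplus>\<^bsub>Hom C 3 1\<^esub>
    (e \<odot>\<^bsub>Hom C 3 1\<^esub> tree23 \<oplus>\<^bsub>Hom C 3 1\<^esub> f \<odot>\<^bsub>Hom C 3 1\<^esub> tree13))))"

definition relation :: "'k \<Rightarrow> 'k \<Rightarrow> 'k \<Rightarrow> 'k \<Rightarrow> 'k \<Rightarrow> 'k \<Rightarrow> bool" where
  "relation a b c d e f \<longleftrightarrow> comb a b c d e f = \<zero>\<^bsub>Hom C 3 1\<^esub>"

lemma smult_sum: "arr f \<Longrightarrow> src f = m \<Longrightarrow> tgt f = n \<Longrightarrow>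
    (a + b) \<odot>\<^bsub>Hom C m n\<^esub> f = a \<odot>\<^bsub>Hom C m n\<^esub> f \<oplus>\<^bsub>Hom C m n\<^esub> b \<odot>\<^bsub>Hom C m n\<^esub> f"
  using hom.smult_l_distr[of a b f m n] by (simp add: hom_iff)

lemma smult_sum_pairs: "arr x \<Longrightarrow> arr r \<Longrightarrow> arr r' \<Longrightarrow> src x = m \<Longrightarrow> tgt x = n \<Longrightarrow>
    src r = m \<Longrightarrow> tgt r = n \<Longrightarrow> src r' = m \<Longrightarrow> tgt r' = n \<Longrightarrow>
    (a \<odot>\<^bsub>Hom C m n\<^esub> x \<oplus>\<^bsub>Hom C m n\<^esub> r) \<oplus>\<^bsub>Hom C m n\<^esub> (b \<odot>\<^bsub>Hom C m n\<^esub> x \<oplus>\<^bsub>Hom C m n\<^esub> r')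
      = (a + b) \<odot>\<^bsub>Hom C m n\<^esub> x \<oplus>\<^bsub>Hom C m n\<^esub> (r \<oplus>\<^bsub>Hom C m n\<^esub> r')"
  by (simp add: smult_sum hom.a_ac hom_iff)

lemma relation_add:
  assumes "relation a b c d e f" "relation a' b' c' d' e' f'"
  shows "relation (a + a') (b + b') (c + c') (d + d') (e + e') (f + f')"
proof -
  have "comb (a + a') (b + b') (c + c') (d + d') (e + e') (f + f')
      = comb a b c d e f \<oplus>\<^bsub>Hom C 3 1\<^esub> comb a' b' c' d' e' f'"
    by (simp add: comb_def smult_sum_pairs flip: smult_sum)
  then show ?thesis using assms by (simp add: relation_def)
qed

lemma relation_scale:
  assumes "relation a b c d e f"
  shows "relation (x * a) (x * b) (x * c) (x * d) (x * e) (x * f)"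
proof -
  have "comb (x * a) (x * b) (x * c) (x * d) (x * e) (x * f) = x \<odot>\<^bsub>Hom C 3 1\<^esub> comb a b c d e f"
    by (simp add: comb_def hom.smult_r_distr hom_iff)
  then show ?thesis using assms hom.smult_r_null[of x 3 1] by (simp add: relation_def)
qed

lemma relation_swap12:
  assumes "relation a b c d e f" shows "relation a c b (- d) (- f) (- e)"
proof -
  have "comb a c b (- d) (- f) (- e) = comb a b c d e f \<cdot> (s \<otimes>\<^sub>m \<i> 1)"
    by (simp add: comb_def chord_swap12 tree_swap12 hom.a_ac hom_iff)
  then show ?thesis using assms by (simp add: relation_def)
qed

lemma relation_swap23:
  assumes "relation a b c d e f" shows "relation c b a f (- e) d"
proof -
  have "comb c b a f (- e) d = comb a b c d e f \<cdot> (\<i> 1 \<otimes>\<^sub>m s)"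
    by (simp add: comb_def chord_swap23 tree_swap23 hom.a_ac hom_iff)
  then show ?thesis using assms by (simp add: relation_def)
qed

lemma relation_closing:
  assumes "(2::'k) \<noteq> 0" "\<i> 1 \<noteq> \<zero>\<^bsub>Hom C 1 1\<^esub>" "relation a b c d e f"
  shows "a + \<delta> * b + c + \<alpha> * (d + f) = 0"
proof -
  have "comb a b c d e f \<cdot> (\<i> 1 \<otimes>\<^sub>m \<eta>) = (a + \<delta> * b + c + \<alpha> * (d + f)) \<odot>\<^bsub>Hom C 1 1\<^esub> \<i> 1"
    using hom.smult_r_null[of e 1 1]
    by (simp add: comb_def chord_closing tree_closing[OF assms(1)] hom_iff algebra_simps
        flip: smult_sum)
  then have "(a + \<delta> * b + c + \<alpha> * (d + f)) \<odot>\<^bsub>Hom C 1 1\<^esub> \<i> 1 = \<zero>\<^bsub>Hom C 1 1\<^esub>"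
    using assms(3) by (simp add: relation_def)
  then show ?thesis using assms(2) by (subst (asm) smult_eq_zero_iff) simp_all
qed

text \<open>Bending turns the two chords into the identity and the swap.  If these agree then
  antisymmetry gives \<open>\<mu> = - \<mu>\<close>, so \<open>\<mu>\<close> vanishes, and with it the scalar \<open>\<alpha>\<close>.\<close>

lemma chords_differ:
  assumes "(2::'k) \<noteq> 0" "\<alpha> \<noteq> 0" "\<i> 1 \<noteq> \<zero>\<^bsub>Hom C 1 1\<^esub>"
  shows "\<not> relation 0 1 (- 1) 0 0 0"
proof
  assume "relation 0 1 (- 1) 0 0 0"
  then have "chord23 \<ominus>\<^bsub>Hom C 3 1\<^esub> chord13 = \<zero>\<^bsub>Hom C 3 1\<^esub>"
    by (simp add: relation_def comb_def hom_smult_minus hom.minus_eq hom_iff)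
  then have "chord23 = chord13" by (simp add: hom_iff)
  then have "s = \<i> 2" using bend_chord by simp
  then have "\<mu> = - 1 \<odot>\<^bsub>Hom C 2 1\<^esub> \<mu>" using mult_swap by simp
  then have "\<mu> = \<zero>\<^bsub>Hom C 2 1\<^esub>" using assms by (intro eq_smult_minus_one_zero) simp_all
  then have "\<alpha> \<odot>\<^bsub>Hom C 1 1\<^esub> \<i> 1 = \<zero>\<^bsub>Hom C 1 1\<^esub>"
    unfolding mult_split[symmetric] by simp
  then show False using assms by (simp add: smult_eq_zero_iff)
qed

text \<open>The bent diagrams are six elements of a space of dimension less than six, and unbending is
  linear.\<close>

lemma diagrams_dependent:
  assumes "vectorspace.fin_dim class_ring (Hom C 2 2)" "vectorspace.dim class_ring (Hom C 2 2) < 6"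
  obtains a b c d e f where "relation a b c d e f" "(a, b, c, d, e, f) \<noteq> (0, 0, 0, 0, 0, 0)"
proof -
  interpret V: vectorspace class_ring "Hom C 2 2" by (rule hom_vectorspace)
  \<comment> \<open>Listed backwards, since a sum over \<open>{5, 4, 3, 2, 1, 0}\<close> unfolds from the largest index.\<close>
  define g where "g i = [tree13, tree23, tree12, chord13, chord23, chord12] ! i" for i
  have g: "arr (g i)" "src (g i) = 3" "tgt (g i) = 1" if "i < 6" for i
    using that by (auto simp: g_def less_Suc_eq numeral_eq_Suc)
  obtain k where k: "(\<Oplus>\<^bsub>Hom C 2 2\<^esub>i\<in>{..<6}. k i \<odot>\<^bsub>Hom C 2 2\<^esub> bend (g i)) = \<zero>\<^bsub>Hom C 2 2\<^esub>"
    and nz: "\<exists>i<6. k i \<noteq> 0"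
    using V.family_dependent[OF assms, of "\<lambda>i. bend (g i)"] g by (auto simp: hom_iff)
  have six: "{..<6::nat} = {5, 4, 3, 2, 1, 0}" by auto
  define S where "S = (\<Oplus>\<^bsub>Hom C 2 2\<^esub>i\<in>{..<6}. k i \<odot>\<^bsub>Hom C 2 2\<^esub> bend (g i))"
  have "S = k 5 \<odot>\<^bsub>Hom C 2 2\<^esub> bend chord12 \<oplus>\<^bsub>Hom C 2 2\<^esub> (k 4 \<odot>\<^bsub>Hom C 2 2\<^esub> bend chord23 \<oplus>\<^bsub>Hom C 2 2\<^esub>
    (k 3 \<odot>\<^bsub>Hom C 2 2\<^esub> bend chord13 \<oplus>\<^bsub>Hom C 2 2\<^esub> (k 2 \<odot>\<^bsub>Hom C 2 2\<^esub> bend tree12 \<oplus>\<^bsub>Hom C 2 2\<^esub>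
    (k 1 \<odot>\<^bsub>Hom C 2 2\<^esub> bend tree23 \<oplus>\<^bsub>Hom C 2 2\<^esub> k 0 \<odot>\<^bsub>Hom C 2 2\<^esub> bend tree13))))"
    unfolding S_def six by (simp add: g_def hom_iff Pi_iff)
  then have "(\<i> 1 \<otimes>\<^sub>m \<epsilon>) \<cdot> (S \<otimes>\<^sub>m \<i> 1) = comb (k 5) (k 4) (k 3) (k 2) (k 1) (k 0)"
    by (simp add: unbend_bend comb_def)
  then have "relation (k 5) (k 4) (k 3) (k 2) (k 1) (k 0)"
    using k by (simp add: S_def relation_def)
  moreover have "(k 5, k 4, k 3, k 2, k 1, k 0) \<noteq> (0, 0, 0, 0, 0, 0)"
  proof -
    have "\<exists>i\<in>{..<6}. k i \<noteq> 0" using nz by auto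
    then show ?thesis unfolding six by auto
  qed
  ultimately show thesis by (rule that)
qed

lemma jacobi_imp_lie:
  assumes "relation 0 0 0 1 (- 1) (- 1)" "Braid C 1 1 = s"
  shows "lie_algebra_object C 1 \<mu>"
proof -
  have "(tree12 \<ominus>\<^bsub>Hom C 3 1\<^esub> tree23) \<ominus>\<^bsub>Hom C 3 1\<^esub> tree13 = \<zero>\<^bsub>Hom C 3 1\<^esub>"
    using assms(1)
    by (simp add: relation_def comb_def hom_smult_minus hom.minus_eq hom.a_assoc hom_iff)
  then have "tree13 = tree12 \<ominus>\<^bsub>Hom C 3 1\<^esub> tree23"
    by (simp add: hom_iff)
  then show ?thesis
    using mult_hom assms(2) mult_swap
    by (simp add: lie_algebra_object_def Let_def tensor_ob diagram_defs hom_smult_minus)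
qed

text \<open>Rescaling the cap by \<open>\<kappa>\<close> and the cup by its inverse keeps the duality relations and
  multiplies every chord by \<open>\<kappa>\<close>.\<close>

lemma relation_imp_vector_product:
  assumes "relation \<kappa> \<kappa> (- 2 * \<kappa>) 1 1 0" "\<kappa> \<noteq> 0" "Braid C 1 1 = s"
  shows "vector_product_algebra_object C 1 \<mu>
    (inverse \<kappa> \<odot>\<^bsub>Hom C 0 2\<^esub> \<eta>) (\<kappa> \<odot>\<^bsub>Hom C 2 0\<^esub> \<epsilon>)"
proof -
  let ?x = "\<kappa> \<odot>\<^bsub>Hom C 3 1\<^esub> chord12" and ?y = "\<kappa> \<odot>\<^bsub>Hom C 3 1\<^esub> chord23"
    and ?z = "(2 * \<kappa>) \<odot>\<^bsub>Hom C 3 1\<^esub> chord13"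
  have "(tree12 \<oplus>\<^bsub>Hom C 3 1\<^esub> tree23) \<ominus>\<^bsub>Hom C 3 1\<^esub> ((?z \<ominus>\<^bsub>Hom C 3 1\<^esub> ?y) \<ominus>\<^bsub>Hom C 3 1\<^esub> ?x)
      = comb \<kappa> \<kappa> (- 2 * \<kappa>) 1 1 0"
    by (simp add: comb_def hom_smult_minus hom.minus_eq hom.minus_add hom.a_ac hom_iff)
  then have "tree12 \<oplus>\<^bsub>Hom C 3 1\<^esub> tree23 = (?z \<ominus>\<^bsub>Hom C 3 1\<^esub> ?y) \<ominus>\<^bsub>Hom C 3 1\<^esub> ?x"
    using assms(1) by (simp add: relation_def hom_iff)
  then show ?thesis
    using mult_hom cup_hom cap_hom assms(2,3) snake1 snake2 split slide_cap cap_swap mult_swap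
    by (simp add: vector_product_algebra_object_def Let_def tensor_ob unit_ob diagram_defs
        hom_smult_minus)
qed

theorem lie_or_vector_product:
  assumes "(2::'k) \<noteq> 0" "\<delta> \<noteq> - 2" "\<alpha> \<noteq> 0" "Braid C 1 1 = s"
    and fin: "vectorspace.fin_dim class_ring (Hom C 2 2)"
    and dim: "vectorspace.dim class_ring (Hom C 2 2) = 5"
  shows "lie_algebra_object C 1 \<mu> \<or> (\<exists>\<eta>' \<epsilon>'. vector_product_algebra_object C 1 \<mu> \<eta>' \<epsilon>')"
proof -
  have id: "\<i> 1 \<noteq> \<zero>\<^bsub>Hom C 1 1\<^esub>" using dim_hom_zero[OF _ fin] dim by force
  have "vectorspace.dim class_ring (Hom C 2 2) < 6" using dim by simp
  then obtain a b c d e f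
    where rel: "relation a b c d e f" and nz: "(a, b, c, d, e, f) \<noteq> (0, 0, 0, 0, 0, 0)"
    using diagrams_dependent[OF fin] by blast
  have "relation 0 0 0 1 (- 1) (- 1) \<or> (\<exists>\<kappa>. \<kappa> \<noteq> 0 \<and> relation \<kappa> \<kappa> (- 2 * \<kappa>) 1 1 0)"
    by (rule relation_space_dichotomy[where N = relation, OF _ _ _ _ _ _ assms(1-3) rel nz])
      (erule (1) relation_add | erule relation_scale relation_swap12 relation_swap23
        relation_closing[OF assms(1) id] | rule chords_differ[OF assms(1,3) id])+
  then show ?thesis using jacobi_imp_lie relation_imp_vector_product assms(4) by blast
qed

end

text \<open>The relations of \<open>trivalent\<close> are equations between morphisms, so the projection carries them
  over.\<close>

locale trivalent_ideal =
  trivalent C \<mu> s \<eta> \<epsilon> \<delta> \<alpha> + linear_pro_ideal C I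
  for C :: "(nat, 'm, 'k::field) monoidal_cat" (structure) and \<mu> s \<eta> \<epsilon> \<delta> \<alpha> I
begin

theorem quotient_trivalent: "trivalent Q (\<pi> \<mu>) (\<pi> s) (\<pi> \<eta>) (\<pi> \<epsilon>) \<delta> \<alpha>"
proof -
  have comp: "\<pi> g \<cdot>\<^bsub>Q\<^esub> \<pi> f = \<pi> (g \<cdot> f)" if "arr g" "arr f" "src g = tgt f" for f g
    using that by (intro proj_comp) (auto simp: hom_iff)
  have tens: "\<pi> f \<otimes>\<^sub>m\<^bsub>Q\<^esub> \<pi> g = \<pi> (f \<otimes>\<^sub>m g)" if "arr g" "arr f" for f g
    using that by (intro proj_tens) (auto simp: hom_iff)
  have smult: "c \<odot>\<^bsub>Hom Q m n\<^esub> \<pi> f = \<pi> (c \<odot>\<^bsub>Hom C m n\<^esub> f)"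
    if "arr f" "src f = m" "tgt f = n" for c f m n
    using that by (intro proj_smult) (auto simp: hom_iff)
  show ?thesis
  proof (rule trivalent.intro[OF quotient_linear_pro trivalent_axioms.intro])
  qed (use mult_hom swap_hom cup_hom cap_hom snake1 snake2 split slide_cap swap_swap slide_mult
      cap_swap mult_swap mult_split cap_cup
      in \<open>simp_all add: proj_hom proj_id comp tens smult\<close>)
qed

end

section \<open>The category given by generators and relations\<close>

text \<open>Expressions have unique types, and these can be computed.  Deciding \<open>typed\<close> by recursion
  leaves all typing obligations to the simplifier.\<close>

primrec tsrc :: "'k tm \<Rightarrow> nat" where
  "tsrc (TId n) = n"
| "tsrc (TZero m n) = m"
| "tsrc Mult = 2"
| "tsrc Swap = 2"
| "tsrc Cup = 0"
| "tsrc Cap = 2"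
| "tsrc (g \<cdot>\<^sub>t f) = tsrc f"
| "tsrc (f \<otimes>\<^sub>t g) = tsrc f + tsrc g"
| "tsrc (f +\<^sub>t g) = tsrc f"
| "tsrc (c *\<^sub>t f) = tsrc f"

primrec ttgt :: "'k tm \<Rightarrow> nat" where
  "ttgt (TId n) = n"
| "ttgt (TZero m n) = n"
| "ttgt Mult = 1"
| "ttgt Swap = 2"
| "ttgt Cup = 2"
| "ttgt Cap = 0"
| "ttgt (g \<cdot>\<^sub>t f) = ttgt g"
| "ttgt (f \<otimes>\<^sub>t g) = ttgt f + ttgt g"
| "ttgt (f +\<^sub>t g) = ttgt f"
| "ttgt (c *\<^sub>t f) = ttgt f"

primrec wt :: "'k tm \<Rightarrow> bool" where
  "wt (TId n) = True"
| "wt (TZero m n) = True"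
| "wt Mult = True"
| "wt Swap = True"
| "wt Cup = True"
| "wt Cap = True"
| "wt (g \<cdot>\<^sub>t f) = (wt g \<and> wt f \<and> tsrc g = ttgt f)"
| "wt (f \<otimes>\<^sub>t g) = (wt f \<and> wt g)"
| "wt (f +\<^sub>t g) = (wt f \<and> wt g \<and> tsrc f = tsrc g \<and> ttgt f = ttgt g)"
| "wt (c *\<^sub>t f) = wt f"

lemma typed_iff: "t : m \<rightarrow>\<^sub>t n \<longleftrightarrow> wt t \<and> tsrc t = m \<and> ttgt t = n"
proof
  show "t : m \<rightarrow>\<^sub>t n \<Longrightarrow> wt t \<and> tsrc t = m \<and> ttgt t = n"
    by (induction rule: typed.induct) auto
  show "wt t \<and> tsrc t = m \<and> ttgt t = n \<Longrightarrow> t : m \<rightarrow>\<^sub>t n"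
    by (induction t arbitrary: m n) (auto intro: typed.intros simp del: One_nat_def)
qed

lemma tcong_typed: "tcong \<delta> \<alpha> t u \<Longrightarrow> wt t \<and> wt u \<and> tsrc t = tsrc u \<and> ttgt t = ttgt u"
  by (induction rule: tcong.induct) (auto simp: typed_iff defining_relations_def)

locale presentation =
  fixes \<delta> \<alpha> :: "'k::field"
begin

abbreviation cls :: "'k tm \<Rightarrow> 'k tm set" where "cls \<equiv> tclass \<delta> \<alpha>"
abbreviation T :: "(nat, 'k tm set, 'k) monoidal_cat" where "T \<equiv> Tcat \<delta> \<alpha>"
abbreviation cong :: "'k tm \<Rightarrow> 'k tm \<Rightarrow> bool" (infix \<open>\<approx>\<close> 50) where "t \<approx> u \<equiv> tcong \<delta> \<alpha> t u"

lemma cls_eqI: "t \<approx> u \<Longrightarrow> cls t = cls u"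
  unfolding tclass_def by (blast intro: tcong.sym tcong.trans)

lemma mem_cls_self: "t : m \<rightarrow>\<^sub>t n \<Longrightarrow> t \<in> cls t"
  unfolding tclass_def by (blast intro: tcong.refl)

lemma cong_type: "t \<approx> u \<Longrightarrow> t : m \<rightarrow>\<^sub>t n \<Longrightarrow> u : m \<rightarrow>\<^sub>t n"
  by (auto simp: typed_iff dest: tcong_typed)

lemma hom_carrier: "carrier (Hom T m n) = {cls t | t. t : m \<rightarrow>\<^sub>t n}"
  by (simp add: Tcat_def)

lemma cls_hom: "t : m \<rightarrow>\<^sub>t n \<Longrightarrow> cls t \<in> carrier (Hom T m n)"
  by (auto simp: hom_carrier)

text \<open>The operations of the category are unions over representatives; a union over a class of
  something that depends only on the class collapses.\<close>

lemma UN_cls_eq: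
  assumes "t : m \<rightarrow>\<^sub>t n" "\<And>t'. t \<approx> t' \<Longrightarrow> F t' = c"
  shows "(\<Union>t' \<in> cls t. F t') = c"
  by (rule SUP_eq_const) (use mem_cls_self[OF assms(1)] assms(2) in \<open>auto simp: tclass_def\<close>)

lemma cls_comp:
  assumes "g : m \<rightarrow>\<^sub>t n" "f : l \<rightarrow>\<^sub>t m"
  shows "cls g \<cdot>\<^bsub>T\<^esub> cls f = cls (g \<cdot>\<^sub>t f)"
  unfolding Tcat_def monoidal_cat.simps
  by (intro UN_cls_eq[OF assms(1)] UN_cls_eq[OF assms(2)] cls_eqI[THEN HOL.sym]
      tcong.comp_cong[OF assms])

lemma cls_tens:
  assumes "f : k \<rightarrow>\<^sub>t l" "g : m \<rightarrow>\<^sub>t n"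
  shows "cls f \<otimes>\<^sub>m\<^bsub>T\<^esub> cls g = cls (f \<otimes>\<^sub>t g)"
  unfolding Tcat_def monoidal_cat.simps
  by (intro UN_cls_eq[OF assms(1)] UN_cls_eq[OF assms(2)] cls_eqI[THEN HOL.sym] tcong.tens_cong)

lemma cls_add:
  assumes "f : m \<rightarrow>\<^sub>t n" "g : m \<rightarrow>\<^sub>t n"
  shows "cls f \<oplus>\<^bsub>Hom T k l\<^esub> cls g = cls (f +\<^sub>t g)"
  unfolding Tcat_def monoidal_cat.simps ring_record_simps
  by (intro UN_cls_eq[OF assms(1)] UN_cls_eq[OF assms(2)] cls_eqI[THEN HOL.sym]
      tcong.add_cong[OF assms])

lemma cls_smult:
  assumes "f : m \<rightarrow>\<^sub>t n"
  shows "c \<odot>\<^bsub>Hom T k l\<^esub> cls f = cls (c *\<^sub>t f)"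
  unfolding Tcat_def monoidal_cat.simps module.simps
  by (intro UN_cls_eq[OF assms] cls_eqI[THEN HOL.sym] tcong.scale_cong)

lemma cls_zero: "\<zero>\<^bsub>Hom T m n\<^esub> = cls (TZero m n)"
  by (simp add: Tcat_def)

lemma cls_id: "\<i>\<^bsub>T\<^esub> n = cls (TId n)"
  by (simp add: Tcat_def)

lemma T_module: "module class_ring (Hom T m n)"
proof (rule moduleI[OF domain.axioms(1)[OF field.axioms(1)[OF class_field]] abelian_groupI])
  fix x assume "x \<in> carrier (Hom T m n)"
  then obtain t where t: "t : m \<rightarrow>\<^sub>t n" "x = cls t" by (auto simp: hom_carrier)
  have "cls (- 1 *\<^sub>t t) \<oplus>\<^bsub>Hom T m n\<^esub> x = \<zero>\<^bsub>Hom T m n\<^esub>"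
    using t by (simp add: cls_add[of _ m n] typed.intros cls_zero cls_eqI[OF tcong.add_neg])
  then show "\<exists>y\<in>carrier (Hom T m n). y \<oplus>\<^bsub>Hom T m n\<^esub> x = \<zero>\<^bsub>Hom T m n\<^esub>"
    using t by (auto simp: hom_carrier intro: typed.intros)
qed (auto simp: hom_carrier cls_zero cls_add[of _ m n] cls_smult[of _ m n] typed.intros
    cls_eqI[OF tcong.add_assoc]
    cls_eqI[OF tcong.add_comm] cls_eqI[OF tcong.add_zero] cls_eqI[OF tcong.scale_add_left]
    cls_eqI[OF tcong.scale_add_right] cls_eqI[OF tcong.scale_scale] cls_eqI[OF tcong.scale_one]
    intro: typed.intros)

text \<open>An operation \<open>F\<close> on classes that is induced by an operation \<open>G\<close> on expressions is linear as
  soon as \<open>G\<close> is so up to the congruence.\<close>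

lemma T_linear:
  assumes "\<And>t. t : k \<rightarrow>\<^sub>t l \<Longrightarrow> G t : m \<rightarrow>\<^sub>t n"
    and "\<And>t. t : k \<rightarrow>\<^sub>t l \<Longrightarrow> F (cls t) = cls (G t)"
    and "\<And>t u. t : k \<rightarrow>\<^sub>t l \<Longrightarrow> u : k \<rightarrow>\<^sub>t l \<Longrightarrow> G (t +\<^sub>t u) \<approx> G t +\<^sub>t G u"
    and "\<And>t c. t : k \<rightarrow>\<^sub>t l \<Longrightarrow> G (c *\<^sub>t t) \<approx> c *\<^sub>t G t"
  shows "F \<in> linear_maps (Hom T k l) (Hom T m n)"
proof -
  have "F (cls t) \<in> carrier (Hom T m n)" if "t : k \<rightarrow>\<^sub>t l" for t
    using that by (simp add: assms(1,2) cls_hom)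
  moreover have "F (cls t \<oplus>\<^bsub>Hom T k l\<^esub> cls u) = F (cls t) \<oplus>\<^bsub>Hom T m n\<^esub> F (cls u)"
    if "t : k \<rightarrow>\<^sub>t l" "u : k \<rightarrow>\<^sub>t l" for t u
    using that by (simp add: assms(1,2) cls_add[of _ k l] cls_add[of _ m n] typed.intros(9)
        cls_eqI[OF assms(3)])
  moreover have "F (c \<odot>\<^bsub>Hom T k l\<^esub> cls t) = c \<odot>\<^bsub>Hom T m n\<^esub> F (cls t)" if "t : k \<rightarrow>\<^sub>t l" for t c
    using that by (simp add: assms(1,2) cls_smult[of _ k l] cls_smult[of _ m n] typed.intros(10)
        cls_eqI[OF assms(4)])
  ultimately show ?thesis unfolding linear_maps_def by (auto simp: hom_carrier)
qed

lemma T_linear_pro: "linear_pro T"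
proof (rule linear_pro.intro)
  show "\<u>\<^bsub>T\<^esub> = 0" "tob T = (+)" by (simp_all add: Tcat_def)
  show "module class_ring (Hom T m n)" for m n by (rule T_module)
  show "m = m' \<and> n = n'" if "f \<in> carrier (Hom T m n)" "f \<in> carrier (Hom T m' n')" for f m n m' n'
  proof -
    obtain t u where "t : m \<rightarrow>\<^sub>t n" "u : m' \<rightarrow>\<^sub>t n'" "cls t = cls u"
      using \<open>f \<in> carrier (Hom T m n)\<close> \<open>f \<in> carrier (Hom T m' n')\<close> by (auto simp: hom_carrier)
    moreover from this have "u \<approx> t" using mem_cls_self[of t m n] by (simp add: tclass_def)
    ultimately show ?thesis using cong_type by (auto simp: typed_iff)
  qed
  show "\<i>\<^bsub>T\<^esub> n \<in> carrier (Hom T n n)" for n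
    by (simp add: cls_id cls_hom typed.intros)
  show "(\<lambda>f. g \<cdot>\<^bsub>T\<^esub> f) \<in> linear_maps (Hom T l m) (Hom T l n)"
    if g: "g \<in> carrier (Hom T m n)" for g l m n
  proof -
    obtain t where "t : m \<rightarrow>\<^sub>t n" "g = cls t" using g by (auto simp: hom_carrier)
    then show ?thesis
      by (intro T_linear[of _ _ "\<lambda>f. t \<cdot>\<^sub>t f"])
        (auto simp: cls_comp intro: typed.intros tcong.comp_add_right tcong.comp_scale_right)
  qed
  show "(\<lambda>g. g \<cdot>\<^bsub>T\<^esub> f) \<in> linear_maps (Hom T m n) (Hom T l n)"
    if f: "f \<in> carrier (Hom T l m)" for f l m n
  proof -
    obtain t where "t : l \<rightarrow>\<^sub>t m" "f = cls t" using f by (auto simp: hom_carrier)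
    then show ?thesis
      by (intro T_linear[of _ _ "\<lambda>g. g \<cdot>\<^sub>t t"])
        (auto simp: cls_comp intro: typed.intros tcong.comp_add_left tcong.comp_scale_left)
  qed
  show "(\<lambda>g. f \<otimes>\<^sub>m\<^bsub>T\<^esub> g) \<in> linear_maps (Hom T m n) (Hom T (k + m) (l + n))"
    if f: "f \<in> carrier (Hom T k l)" for f k l m n
  proof -
    obtain t where "t : k \<rightarrow>\<^sub>t l" "f = cls t" using f by (auto simp: hom_carrier)
    then show ?thesis
      by (intro T_linear[of _ _ "\<lambda>g. t \<otimes>\<^sub>t g"])
        (auto simp: cls_tens intro: typed.intros tcong.tens_add_right tcong.tens_scale_right)
  qed
  show "(\<lambda>f. f \<otimes>\<^sub>m\<^bsub>T\<^esub> g) \<in> linear_maps (Hom T k l) (Hom T (k + m) (l + n))"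
    if g: "g \<in> carrier (Hom T m n)" for g k l m n
  proof -
    obtain t where "t : m \<rightarrow>\<^sub>t n" "g = cls t" using g by (auto simp: hom_carrier)
    then show ?thesis
      by (intro T_linear[of _ _ "\<lambda>f. f \<otimes>\<^sub>t t"])
        (auto simp: cls_tens intro: typed.intros tcong.tens_add_left tcong.tens_scale_left)
  qed
  show "\<i>\<^bsub>T\<^esub> m \<otimes>\<^sub>m\<^bsub>T\<^esub> \<i>\<^bsub>T\<^esub> n = \<i>\<^bsub>T\<^esub> (m + n)" for m n
    by (simp add: cls_id cls_tens[of _ m m _ n n] typed.intros cls_eqI[OF tcong.tens_id])
  show "(h \<cdot>\<^bsub>T\<^esub> g) \<cdot>\<^bsub>T\<^esub> f = h \<cdot>\<^bsub>T\<^esub> (g \<cdot>\<^bsub>T\<^esub> f)"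
    if "h \<in> carrier (Hom T m n)" "g \<in> carrier (Hom T l m)" "f \<in> carrier (Hom T k l)"
    for h g f k l m n
    using that by (auto simp: hom_carrier cls_comp
        cls_comp[OF typed.intros(7)] cls_comp[OF _ typed.intros(7)] cls_eqI[OF tcong.comp_assoc])
qed (auto simp: hom_carrier cls_id cls_comp cls_tens typed.intros(1)
    cls_comp[OF typed.intros(1)] cls_comp[OF _ typed.intros(1)]
    cls_tens[OF typed.intros(1)] cls_tens[OF _ typed.intros(1)]
    cls_tens[OF typed.intros(8)] cls_tens[OF _ typed.intros(8)]
    cls_tens[OF typed.intros(7) typed.intros(7)] cls_comp[OF typed.intros(8) typed.intros(8)]
    cls_eqI[OF tcong.id_comp] cls_eqI[OF tcong.comp_id] cls_eqI[OF tcong.tens_assoc]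
    cls_eqI[OF tcong.unit_tens] cls_eqI[OF tcong.tens_unit] cls_eqI[OF tcong.interchange])

sublocale linear_pro T by (rule T_linear_pro)

lemma cls_arr [simp]: "wt t \<Longrightarrow> arr (cls t)" "wt t \<Longrightarrow> src (cls t) = tsrc t"
  "wt t \<Longrightarrow> tgt (cls t) = ttgt t"
  using cls_hom[of t "tsrc t" "ttgt t"] by (auto simp: typed_iff hom_iff)

text \<open>Read from left to right, these push the formation of classes down to the generators and so
  translate a relation between expressions into one between diagrams.\<close>

lemma cls_simps:
  "wt (g \<cdot>\<^sub>t f) \<Longrightarrow> cls (g \<cdot>\<^sub>t f) = cls g \<cdot>\<^bsub>T\<^esub> cls f"
  "wt (f \<otimes>\<^sub>t g) \<Longrightarrow> cls (f \<otimes>\<^sub>t g) = cls f \<otimes>\<^sub>m\<^bsub>T\<^esub> cls g"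
  "wt (c *\<^sub>t f) \<Longrightarrow> cls (c *\<^sub>t f) = c \<odot>\<^bsub>Hom T (tsrc f) (ttgt f)\<^esub> cls f"
  "cls (TId n) = \<i>\<^bsub>T\<^esub> n"
  using cls_comp[of g "tsrc g" "ttgt g" f "tsrc f"]
    cls_tens[of f "tsrc f" "ttgt f" g "tsrc g" "ttgt g"]
    cls_smult[of f "tsrc f" "ttgt f"]
  by (auto simp: typed_iff cls_id)

lemma cls_relation: "(t, u) \<in> defining_relations \<delta> \<alpha> \<Longrightarrow> cls t = cls u"
  by (rule cls_eqI[OF tcong.rel])

lemma T_trivalent: "trivalent T (cls Mult) (cls Swap) (cls Cup) (cls Cap) \<delta> \<alpha>"
proof -
  \<comment> \<open>An implication, so that the simplifier discharges the membership.\<close>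
  have r: "(t, u) \<in> defining_relations \<delta> \<alpha> \<longrightarrow> cls t = cls u" for t u using cls_relation by blast
  show ?thesis
    using r[of "(Cap \<otimes>\<^sub>t \<one>\<^sub>t) \<cdot>\<^sub>t (\<one>\<^sub>t \<otimes>\<^sub>t Cup)" "\<one>\<^sub>t"]
      r[of "\<one>\<^sub>t" "(\<one>\<^sub>t \<otimes>\<^sub>t Cap) \<cdot>\<^sub>t (Cup \<otimes>\<^sub>t \<one>\<^sub>t)"]
      r[of "\<sigma>\<^sub>t" "(Mult \<otimes>\<^sub>t \<one>\<^sub>t) \<cdot>\<^sub>t (\<one>\<^sub>t \<otimes>\<^sub>t Cup)"]
      r[of "(\<one>\<^sub>t \<otimes>\<^sub>t Cap) \<cdot>\<^sub>t (Swap \<otimes>\<^sub>t \<one>\<^sub>t)" "(Cap \<otimes>\<^sub>t \<one>\<^sub>t) \<cdot>\<^sub>t (\<one>\<^sub>t \<otimes>\<^sub>t Swap)"]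
      r[of "Swap \<cdot>\<^sub>t Swap" "\<one>\<^sub>t \<otimes>\<^sub>t \<one>\<^sub>t"]
      r[of "(\<one>\<^sub>t \<otimes>\<^sub>t Mult) \<cdot>\<^sub>t (Swap \<otimes>\<^sub>t \<one>\<^sub>t) \<cdot>\<^sub>t (\<one>\<^sub>t \<otimes>\<^sub>t Swap)" "Swap \<cdot>\<^sub>t (Mult \<otimes>\<^sub>t \<one>\<^sub>t)"]
      r[of "Cap \<cdot>\<^sub>t Swap" Cap] r[of "Mult \<cdot>\<^sub>t Swap" "- 1 *\<^sub>t Mult"]
      r[of "Mult \<cdot>\<^sub>t \<sigma>\<^sub>t" "\<alpha> *\<^sub>t \<one>\<^sub>t"] r[of "Cap \<cdot>\<^sub>t Cup" "\<delta> *\<^sub>t TId 0"]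
    by (intro trivalent.intro T_linear_pro trivalent_axioms.intro)
      (simp_all add: defining_relations_def cls_simps hom_iff numeral_2_eq_2)
qed

lemma braid_swap: "Braid T 1 1 = cls Swap"
  by (simp add: Tcat_def) (simp add: cls_simps)

end

lemma two_neq_zero: "CHAR('k::field) \<noteq> 2 \<Longrightarrow> (2::'k) \<noteq> 0"
proof
  assume *: "CHAR('k) \<noteq> 2" "(2::'k) = 0"
  then have "of_nat 2 = (0::'k)" by simp
  then have "CHAR('k) dvd 2" by (simp only: of_nat_eq_0_iff_char_dvd)
  then show False using *(1) CHAR_not_1[where 'a='k]
    by (metis One_nat_def prime_nat_iff two_is_prime_nat)
qed

theorem proposition3p17:
  fixes \<delta> \<alpha> :: "'k::field" and I :: "nat \<Rightarrow> nat \<Rightarrow> 'k tm set set"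
  defines "T \<equiv> Tcat \<delta> \<alpha>"
  defines "Q \<equiv> quotient_cat T I"
  defines "X \<equiv> 1"
  defines "m \<equiv> ideal_coset T I (tclass \<delta> \<alpha> Mult)"
  defines "E \<equiv> Hom Q (X \<otimes>\<^sub>o\<^bsub>Q\<^esub> X) (X \<otimes>\<^sub>o\<^bsub>Q\<^esub> X)"
  assumes "CHAR('k) \<noteq> 2" and "\<delta> \<noteq> - 2" and "\<alpha> \<noteq> 0"
    and "tensor_ideal T I"
    and "vectorspace.fin_dim class_ring E" and "vectorspace.dim class_ring E = 5"
  shows "lie_algebra_object Q X m \<or> (\<exists>\<eta> \<epsilon>. vector_product_algebra_object Q X m \<eta> \<epsilon>)"
proof -
  interpret presentation \<delta> \<alpha> .
  interpret trivalent_ideal "Tcat \<delta> \<alpha>" "cls Mult" "cls Swap" "cls Cup" "cls Cap" \<delta> \<alpha> I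
    using T_trivalent \<open>tensor_ideal T I\<close>
    by (simp add: trivalent_ideal_def linear_pro_ideal_def linear_pro_ideal_axioms_def
        T_linear_pro T_def)
  interpret quot: trivalent Q m "proj (cls Swap)" "proj (cls Cup)" "proj (cls Cap)" \<delta> \<alpha>
    unfolding Q_def m_def T_def by (rule quotient_trivalent)
  have E: "E = Hom Q 2 2" by (simp add: E_def X_def quot.tensor_ob)
  have "Braid Q 1 1 = proj (cls Swap)"
    by (simp add: Q_def quotient_cat_def T_def braid_swap del: One_nat_def)
  then show ?thesis
    unfolding X_def using assms two_neq_zero by (intro quot.lie_or_vector_product) (simp_all add: E)
qed

end
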